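(* Let $m\ge1$, let $X^1,\dots,X^m$ be independent random variables with values in finite sets $\mathcal X_1,\dots,\mathcal X_m$, let $f$ be a function on $\mathcal X_1\times\dots\times\mathcal X_m$, let $t\ge1$, and let $U^1,\dots,U^t$ be binary random variables, jointly distributed with $X^{1:m}=(X^1,\dots,X^m)$, such that $H(f(X^{1:m})\mid U^{1:t})=0$ and, for every $i\in\{1,\dots,t\}$ with $j=((i-1)\bmod m)+1$, $U^i\to(U^{1:i-1},X^j)\to(X^{1:j-1},X^{j+1:m})$ is a Markov chain. Let $0<\beta_7<\beta<1/2$. For $N=2^n$ consider the $t$-round broadcast protocol described in the context (with $\delta_N=2^{-N^\beta}$). For a round $l\in\{1,\dots,t\}$ let $(U^l)_j^{1:N}$ be the sequence generated by the broadcasting terminal $j=((l-1)\bmod m)+1$, and for a terminal $r\ne j$ let $(U^l)_r^{1:N}$ be the sequence computed by terminal $r$ after that broadcast. Then, as $N\to\infty$, for all $l\in\{1,\dots,t\}$ and all terminals $r\neq j$, $$\Pr\{(U^l)_j^{1:N}=(U^l)_r^{1:N}\}=1-O(2^{-N^{\beta_7}}),$$ and $$\big\|Q_{\mathbf U^{1:t}\mathbf X^{1:m}}-P_{\mathbf U^{1:t}\mathbf X^{1:m}}\big\|_1=O(2^{-N^{\beta_7}}),$$ where $P_{\mathbf U^{1:t}\mathbf X^{1:m}}$ is the law of $N$ i.i.d. copies of $(U^1,\dots,U^t,X^1,\dots,X^m)$ and $Q_{\mathbf U^{1:t}\mathbf X^{1:m}}$ is the distribution defined in the context.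
   Context: Polarization notation. $N=2^n$, $n\in\mathbb N$; $[N]=\{1,\dots,N\}$; $\delta_N=2^{-N^\beta}$. A bar denotes an $N$-vector, $w^{1:k}=(w^1,\dots,w^k)$, $U^{1:k}=(U^1,\dots,U^k)$. $G_N=B_NF^{\otimes n}$ over $\mathbb F_2$, where $F=\begin{pmatrix}1&0\\1&1\end{pmatrix}$, $\otimes$ is the Kronecker product and $B_N$ is the $N\times N$ bit-reversal permutation matrix. For a binary random variable $T$ and a discrete random variable $V$, $Z(T|V)=2\sum_{v}P_V(v)\sqrt{P_{T|V}(0|v)P_{T|V}(1|v)}$. For a binary $U$ and a discrete $W$ with a given joint law, let $(\bar U,\bar W)$ be $N$ i.i.d. copies of $(U,W)$ and $\bar V=\bar UG_N$; put $\mathcal L_U=\{k\in[N]:Z(V^k|V^{1:k-1})\le\delta_N\}$, $\mathcal L_{U|W}=\{k\in[N]:Z(V^k|V^{1:k-1},\bar W)\le\delta_N\}$, $\mathcal H_{U|W}=\{k\in[N]:Z(V^k|V^{1:k-1},\bar W)\ge1-\delta_N\}$. The superscript $c$ is complement in $[N]$. Ideal distribution. $P$ denotes the law of $(\bar X^1,\dots,\bar X^m,\bar U^1,\dots,\bar U^t,\bar V^1,\dots,\bar V^t)$, where $(\bar X^1,\dots,\bar X^m,\bar U^1,\dots,\bar U^t)$ are $N$ i.i.d. copies of $(X^1,\dots,X^m,U^1,\dots,U^t)$ and $\bar V^i=\bar U^iG_N$; its marginals and conditionals are also denoted $P$ (conditional laws given zero-probability events are fixed arbitrarily). $\mathbf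 X^{1:m}=(\bar X^1,\dots,\bar X^m)$, $\mathbf U^{1:t}=(\bar U^1,\dots,\bar U^t)$. Index sets. For round $i$, with $j=((i-1)\bmod m)+1$: $\mathcal F_r^i=\mathcal L^c_{U^i}\cap\mathcal H_{U^i|(X^j,U^{1:i-1})}$, $\mathcal F_d^i=\mathcal L_{U^i}$, $\mathcal I^i=\mathcal L^c_{U^i}\cap\mathcal H^c_{U^i|(X^j,U^{1:i-1})}$, $\mathcal I'^i=\mathcal I^i\setminus(\mathcal L^c_{U^i}\cap\mathcal L_{U^i|U^{1:i-1}})$ (so $\mathcal I'^1=\mathcal I^1$). Generation kernel. $Q^{(i)}_k((v^i)^k|(v^i)^{1:k-1},\bar x^j,\mathbf u^{1:i-1})$ equals $1/2$ if $k\in\mathcal F_r^i$; $P_{(V^i)^k|(V^i)^{1:k-1}}((v^i)^k|(v^i)^{1:k-1})$ if $k\in\mathcal F_d^i$; $P_{(V^i)^k|(V^i)^{1:k-1},\bar X^j,\mathbf U^{1:i-1}}((v^i)^k|(v^i)^{1:k-1},\bar x^j,\mathbf u^{1:i-1})$ if $k\in\mathcal I^i$. Distribution $Q$. $Q_{\mathbf U^{1:t}\mathbf X^{1:m}}$ is the marginal of $$Q(\mathbf u^{1:t},\mathbf v^{1:t},\mathbf x^{1:m})=\prod_{k=1}^NP_{X^{1:m}}((x^1)^k,\dots,(x^m)^k)\prod_{i=1}^t\mathbf 1(\bar u^iG_N=\bar v^i)\prod_{i=1}^t\prod_{k=1}^NQ_k^{(i)}((v^i)^k|(v^i)^{1:k-1},\bar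 x^j,\mathbf u^{1:i-1}),$$ with $j=((i-1)\bmod m)+1$ in the $i$th factor. Protocol. There are $m$ source terminals and one sink terminal; source terminal $j$ observes $\bar X^j$, where $(\bar X^1,\dots,\bar X^m)$ are $N$ i.i.d. copies of $X^{1:m}$; the sink observes nothing. In round $i=1,\dots,t$ the broadcaster is terminal $j=((i-1)\bmod m)+1$; it generates $\bar v^i$ successively, sampling $(v^i)^k$ from $Q_k^{(i)}(\cdot|(v^i)^{1:k-1},\bar x^j,\mathbf u^{1:i-1})$, $k=1,\dots,N$, and broadcasts the bits $(v^i)^k$, $k\in\mathcal I'^i$, which all terminals receive correctly. Every other terminal $r$ (including the sink) forms its own version of $\bar v^i$: it copies the received bits for $k\in\mathcal I'^i$; for $k\in\mathcal F_r^i$ it uses the same uniform bit as the broadcaster (shared randomness); for $k\in\mathcal F_d^i$ it samples from $P_{(V^i)^k|(V^i)^{1:k-1}}(\cdot|(v^i)^{1:k-1})$; for $k\in\mathcal I^i\setminus\mathcal I'^i$ it samples from $P_{(V^i)^k|(V^i)^{1:k-1},\mathbf U^{1:i-1}}(\cdot|(v^i)^{1:k-1},\mathbf u^{1:i-1})$. Each terminal uses its own versions of $(v^i)^{1:k-1}$ and $\mathbf u^{1:i-1}$. The private samplings at different terminals use independent randomness, and shared bits are independent of everything else. Each terminal then sets $\bar u^i=\bar v^iG_N$. $\|\cdot\|_1$ is the $\ell_1$ distance between probability mass functions. The constants in $O(\cdot)$ do not depend on $N$. *)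

theory Defs
  imports
    "HOL-Probability.Probability"
    "HOL-Library.Z2"
    "HOL-Library.Landau_Symbols"
    "Jordan_Normal_Form.Matrix"
begin

text \<open>
  All indices start at 0: there are source terminals \<open>0, \<dots>, m - 1\<close>, rounds \<open>0, \<dots>, t - 1\<close> and bit
  positions \<open>0, \<dots>, N - 1\<close>. The broadcaster of round \<open>i\<close> is terminal \<open>i mod m\<close>, and terminal \<open>m\<close>
  is the sink. Vectors are lists; \<open>take k v\<close> is the part of \<open>v\<close> strictly before position \<open>k\<close>.
\<close>

definition law_pmf :: "'w measure \<Rightarrow> ('w \<Rightarrow> 'c) \<Rightarrow> 'c pmf" where
  \<comment> \<open>meant for \<open>Y\<close> that is measurable into \<open>count_space UNIV\<close> and has finite range\<close>
  "law_pmf M Y = Abs_pmf (distr M (count_space UNIV) Y)"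

definition markov_chain :: "'w measure \<Rightarrow> ('w \<Rightarrow> 'b) \<Rightarrow> ('w \<Rightarrow> 'c) \<Rightarrow> ('w \<Rightarrow> 'd) \<Rightarrow> bool" where
  \<comment> \<open>\<open>A \<rightarrow> B \<rightarrow> C\<close> for discrete random variables: \<open>P(a, c | b) = P(a | b) P(c | b)\<close>,
      multiplied out so that nothing is claimed when \<open>P(b) = 0\<close>\<close>
  "markov_chain M A B C \<longleftrightarrow> (\<forall>a b c.
     \<P>(\<omega> in M. A \<omega> = a \<and> B \<omega> = b \<and> C \<omega> = c) * \<P>(\<omega> in M. B \<omega> = b) =
     \<P>(\<omega> in M. A \<omega> = a \<and> B \<omega> = b) * \<P>(\<omega> in M. B \<omega> = b \<and> C \<omega> = c))"

definition bhattacharyya :: "'s pmf \<Rightarrow> ('s \<Rightarrow> bit) \<Rightarrow> ('s \<Rightarrow> 'v) \<Rightarrow> real" where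
  "bhattacharyya p T V = 2 * (\<Sum>\<^sub>\<infinity>v. \<P>(\<omega> in p. V \<omega> = v) *
     sqrt (\<P>(\<omega> in p. T \<omega> = 0 \<bar> V \<omega> = v) * \<P>(\<omega> in p. T \<omega> = 1 \<bar> V \<omega> = v)))"

text \<open>\<open>d\<close> is the arbitrary choice of the conditional laws given events of probability 0.\<close>

definition cond_law :: "('b \<Rightarrow> 'c pmf) \<Rightarrow> 's pmf \<Rightarrow> ('s \<Rightarrow> 'c) \<Rightarrow> ('s \<Rightarrow> 'b) \<Rightarrow> 'b \<Rightarrow> 'c pmf" where
  "cond_law d p A B b =
     (if b \<in> B ` set_pmf p then map_pmf A (cond_pmf p {\<omega>. B \<omega> = b}) else d b)"

definition kronecker :: "'a::times mat \<Rightarrow> 'a mat \<Rightarrow> 'a mat" where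
  "kronecker A B = mat (dim_row A * dim_row B) (dim_col A * dim_col B)
     (\<lambda>(i, j). A $$ (i div dim_row B, j div dim_col B) * B $$ (i mod dim_row B, j mod dim_col B))"

definition polar_F :: "bit mat" where
  "polar_F = mat_of_rows_list 2 [[1, 0], [1, 1]]"

primrec polar_F_power :: "nat \<Rightarrow> bit mat" where
  "polar_F_power 0 = 1\<^sub>m 1"
| "polar_F_power (Suc n) = kronecker polar_F (polar_F_power n)"

primrec bit_reverse :: "nat \<Rightarrow> nat \<Rightarrow> nat" where
  "bit_reverse 0 i = 0"
| "bit_reverse (Suc n) i = 2 ^ n * (i mod 2) + bit_reverse n (i div 2)"

definition bit_reversal_mat :: "nat \<Rightarrow> bit mat" where
  "bit_reversal_mat n = mat (2 ^ n) (2 ^ n) (\<lambda>(i, j). if j = bit_reverse n i then 1 else 0)"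

definition polar_G :: "nat \<Rightarrow> bit mat" where
  "polar_G n = bit_reversal_mat n * polar_F_power n"

text \<open>The product \<open>u G\<close> of a row vector \<open>u\<close> of length \<open>2 ^ n\<close> with \<open>G\<close>.\<close>

definition polar :: "nat \<Rightarrow> bit list \<Rightarrow> bit list" where
  "polar n u = list_of_vec (transpose_mat (polar_G n) *\<^sub>v vec_of_list u)"

definition delta :: "real \<Rightarrow> nat \<Rightarrow> real" where
  "delta \<beta> n = 2 powr - (real (2 ^ n) powr \<beta>)"

text \<open>
  \<open>p\<close> is the law of one symbol, and \<open>U\<close>, \<open>W\<close> are functions of that symbol; the i.i.d. copies
  of \<open>(U, W)\<close> are obtained by applying \<open>U\<close> and \<open>W\<close> to the entries of \<open>\<omega>\<close>.
\<close>

definition low_set :: "'s pmf \<Rightarrow> real \<Rightarrow> nat \<Rightarrow> ('s \<Rightarrow> bit) \<Rightarrow> nat set" where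
  "low_set p \<beta> n U = {k \<in> {..<2 ^ n}.
     bhattacharyya (replicate_pmf (2 ^ n) p)
       (\<lambda>\<omega>. polar n (map U \<omega>) ! k) (\<lambda>\<omega>. take k (polar n (map U \<omega>))) \<le> delta \<beta> n}"

definition low_set_cond :: "'s pmf \<Rightarrow> real \<Rightarrow> nat \<Rightarrow> ('s \<Rightarrow> bit) \<Rightarrow> ('s \<Rightarrow> 'b) \<Rightarrow> nat set" where
  "low_set_cond p \<beta> n U W = {k \<in> {..<2 ^ n}.
     bhattacharyya (replicate_pmf (2 ^ n) p)
       (\<lambda>\<omega>. polar n (map U \<omega>) ! k) (\<lambda>\<omega>. (take k (polar n (map U \<omega>)), map W \<omega>)) \<le> delta \<beta> n}"

definition high_set_cond :: "'s pmf \<Rightarrow> real \<Rightarrow> nat \<Rightarrow> ('s \<Rightarrow> bit) \<Rightarrow> ('s \<Rightarrow> 'b) \<Rightarrow> nat set" where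
  "high_set_cond p \<beta> n U W = {k \<in> {..<2 ^ n}.
     bhattacharyya (replicate_pmf (2 ^ n) p)
       (\<lambda>\<omega>. polar n (map U \<omega>) ! k) (\<lambda>\<omega>. (take k (polar n (map U \<omega>)), map W \<omega>)) \<ge> 1 - delta \<beta> n}"

text \<open>
  From here on, one symbol is a pair \<open>(xs, us)\<close> with \<open>xs = [X 0, \<dots>, X (m - 1)]\<close> and
  \<open>us = [U 0, \<dots>, U (t - 1)]\<close>.
\<close>

type_synonym 'a symbol = "'a list \<times> bit list"

definition low_U :: "'a symbol pmf \<Rightarrow> real \<Rightarrow> nat \<Rightarrow> nat \<Rightarrow> nat set" where
  "low_U p \<beta> n i = low_set p \<beta> n (\<lambda>s. snd s ! i)"

definition low_U_past :: "'a symbol pmf \<Rightarrow> real \<Rightarrow> nat \<Rightarrow> nat \<Rightarrow> nat set" where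
  "low_U_past p \<beta> n i = low_set_cond p \<beta> n (\<lambda>s. snd s ! i) (\<lambda>s. take i (snd s))"

definition high_U :: "'a symbol pmf \<Rightarrow> nat \<Rightarrow> real \<Rightarrow> nat \<Rightarrow> nat \<Rightarrow> nat set" where
  "high_U p m \<beta> n i =
     high_set_cond p \<beta> n (\<lambda>s. snd s ! i) (\<lambda>s. (fst s ! (i mod m), take i (snd s)))"

definition F_rand :: "'a symbol pmf \<Rightarrow> nat \<Rightarrow> real \<Rightarrow> nat \<Rightarrow> nat \<Rightarrow> nat set" where
  "F_rand p m \<beta> n i = ({..<2 ^ n} - low_U p \<beta> n i) \<inter> high_U p m \<beta> n i"

definition F_det :: "'a symbol pmf \<Rightarrow> real \<Rightarrow> nat \<Rightarrow> nat \<Rightarrow> nat set" where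
  "F_det p \<beta> n i = low_U p \<beta> n i"

definition I_info :: "'a symbol pmf \<Rightarrow> nat \<Rightarrow> real \<Rightarrow> nat \<Rightarrow> nat \<Rightarrow> nat set" where
  "I_info p m \<beta> n i = ({..<2 ^ n} - low_U p \<beta> n i) \<inter> ({..<2 ^ n} - high_U p m \<beta> n i)"

definition I_sent :: "'a symbol pmf \<Rightarrow> nat \<Rightarrow> real \<Rightarrow> nat \<Rightarrow> nat \<Rightarrow> nat set" where
  "I_sent p m \<beta> n i =
     I_info p m \<beta> n i - (({..<2 ^ n} - low_U p \<beta> n i) \<inter> low_U_past p \<beta> n i)"

definition ideal :: "'a symbol pmf \<Rightarrow> nat \<Rightarrow> 'a symbol list pmf" where
  "ideal p n = replicate_pmf (2 ^ n) p"

definition X_vec :: "nat \<Rightarrow> 'a symbol list \<Rightarrow> 'a list" where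
  "X_vec j \<omega> = map (\<lambda>s. fst s ! j) \<omega>"

definition U_vec :: "nat \<Rightarrow> 'a symbol list \<Rightarrow> bit list" where
  "U_vec i \<omega> = map (\<lambda>s. snd s ! i) \<omega>"

definition V_vec :: "nat \<Rightarrow> nat \<Rightarrow> 'a symbol list \<Rightarrow> bit list" where
  "V_vec n i \<omega> = polar n (U_vec i \<omega>)"

text \<open>
  The values of the conditional laws of bit \<open>k\<close> of \<open>V i\<close> at blocklength \<open>2 ^ n\<close> given events of
  probability 0, as functions of \<open>n\<close>, \<open>i\<close>, \<open>k\<close> and the conditioning value.
\<close>

record 'a null_laws =
  null_V :: "nat \<Rightarrow> nat \<Rightarrow> nat \<Rightarrow> bit list \<Rightarrow> bit pmf"
  null_VU :: "nat \<Rightarrow> nat \<Rightarrow> nat \<Rightarrow> bit list \<times> bit list list \<Rightarrow> bit pmf"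
  null_VXU :: "nat \<Rightarrow> nat \<Rightarrow> nat \<Rightarrow> bit list \<times> 'a list \<times> bit list list \<Rightarrow> bit pmf"

definition law_V :: "'a symbol pmf \<Rightarrow> 'a null_laws \<Rightarrow> nat \<Rightarrow> nat \<Rightarrow> nat \<Rightarrow> bit list \<Rightarrow> bit pmf" where
  "law_V p D n i k = cond_law (null_V D n i k) (ideal p n)
     (\<lambda>\<omega>. V_vec n i \<omega> ! k)
     (\<lambda>\<omega>. take k (V_vec n i \<omega>))"

definition law_VU ::
  "'a symbol pmf \<Rightarrow> 'a null_laws \<Rightarrow> nat \<Rightarrow> nat \<Rightarrow> nat \<Rightarrow> bit list \<times> bit list list \<Rightarrow> bit pmf" where
  "law_VU p D n i k = cond_law (null_VU D n i k) (ideal p n)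
     (\<lambda>\<omega>. V_vec n i \<omega> ! k)
     (\<lambda>\<omega>. (take k (V_vec n i \<omega>), map (\<lambda>l. U_vec l \<omega>) [0..<i]))"

definition law_VXU ::
  "'a symbol pmf \<Rightarrow> nat \<Rightarrow> 'a null_laws \<Rightarrow> nat \<Rightarrow> nat \<Rightarrow> nat \<Rightarrow>
   bit list \<times> 'a list \<times> bit list list \<Rightarrow> bit pmf" where
  "law_VXU p m D n i k = cond_law (null_VXU D n i k) (ideal p n)
     (\<lambda>\<omega>. V_vec n i \<omega> ! k)
     (\<lambda>\<omega>. (take k (V_vec n i \<omega>), X_vec (i mod m) \<omega>, map (\<lambda>l. U_vec l \<omega>) [0..<i]))"

text \<open>
  \<open>v\<close> is the prefix of length \<open>k\<close>, \<open>x\<close> the source vector of the broadcaster, \<open>us\<close> the list of the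
  \<open>i\<close> previous vectors. On positions \<open>k < 2 ^ n\<close> the last branch is exactly \<open>k \<in> I_info p m \<beta> n i\<close>.
\<close>

definition gen_kernel ::
  "'a symbol pmf \<Rightarrow> nat \<Rightarrow> real \<Rightarrow> 'a null_laws \<Rightarrow> nat \<Rightarrow> nat \<Rightarrow> nat \<Rightarrow>
   bit list \<Rightarrow> 'a list \<Rightarrow> bit list list \<Rightarrow> bit pmf" where
  "gen_kernel p m \<beta> D n i k v x us =
     (if k \<in> F_rand p m \<beta> n i then pmf_of_set {0, 1}
      else if k \<in> F_det p \<beta> n i then law_V p D n i k v
      else law_VXU p m D n i k (v, x, us))"

definition bit_vecs :: "nat \<Rightarrow> nat \<Rightarrow> bit list list set" where
  "bit_vecs t N = {us. length us = t \<and> (\<forall>u \<in> set us. length u = N)}"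

definition source_vecs :: "(nat \<Rightarrow> 'a set) \<Rightarrow> nat \<Rightarrow> nat \<Rightarrow> 'a list list set" where
  "source_vecs \<X> m N =
     {xs. length xs = m \<and> (\<forall>j<m. length (xs ! j) = N \<and> set (xs ! j) \<subseteq> \<X> j)}"

definition Q_UVX ::
  "'a symbol pmf \<Rightarrow> nat \<Rightarrow> nat \<Rightarrow> real \<Rightarrow> 'a null_laws \<Rightarrow> nat \<Rightarrow>
   bit list list \<Rightarrow> bit list list \<Rightarrow> 'a list list \<Rightarrow> real" where
  "Q_UVX p m t \<beta> D n us vs xs =
     (\<Prod>k<2 ^ n. pmf (map_pmf fst p) (map (\<lambda>x. x ! k) xs)) *
     (\<Prod>i<t. if polar n (us ! i) = vs ! i then 1 else 0) *
     (\<Prod>i<t. \<Prod>k<2 ^ n.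
        pmf (gen_kernel p m \<beta> D n i k (take k (vs ! i)) (xs ! (i mod m)) (take i us)) (vs ! i ! k))"

definition Q_UX ::
  "'a symbol pmf \<Rightarrow> nat \<Rightarrow> nat \<Rightarrow> real \<Rightarrow> 'a null_laws \<Rightarrow> nat \<Rightarrow>
   bit list list \<Rightarrow> 'a list list \<Rightarrow> real" where
  "Q_UX p m t \<beta> D n us xs = (\<Sum>vs \<in> bit_vecs t (2 ^ n). Q_UVX p m t \<beta> D n us vs xs)"

definition P_UX ::
  "'a symbol pmf \<Rightarrow> nat \<Rightarrow> nat \<Rightarrow> nat \<Rightarrow> bit list list \<Rightarrow> 'a list list \<Rightarrow> real" where
  "P_UX p m t n us xs =
     pmf (map_pmf (\<lambda>\<omega>. (map (\<lambda>i. U_vec i \<omega>) [0..<t], map (\<lambda>j. X_vec j \<omega>) [0..<m])) (ideal p n))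
         (us, xs)"

definition l1_dist :: "'b set \<Rightarrow> ('b \<Rightarrow> real) \<Rightarrow> ('b \<Rightarrow> real) \<Rightarrow> real" where
  "l1_dist S P Q = (\<Sum>z\<in>S. \<bar>P z - Q z\<bar>)"

primrec sequential_pmf :: "(nat \<Rightarrow> bit list \<Rightarrow> bit pmf) \<Rightarrow> nat \<Rightarrow> bit list pmf" where
  "sequential_pmf \<kappa> 0 = return_pmf []"
| "sequential_pmf \<kappa> (Suc k) =
     do {v \<leftarrow> sequential_pmf \<kappa> k; b \<leftarrow> \<kappa> k v; return_pmf (v @ [b])}"

text \<open>
  How a non-broadcasting terminal obtains bit \<open>k\<close>: \<open>vb\<close> is the vector of the broadcaster, \<open>v\<close> and
  \<open>us\<close> are the versions held by this terminal. On \<open>I_sent\<close> the bit of \<open>vb\<close> is received; on \<open>F_rand\<close>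
  the broadcaster has used a shared uniform bit, so taking the same shared bit is also copying
  from \<open>vb\<close>. On positions \<open>k < 2 ^ n\<close> the last branch is exactly \<open>I_info - I_sent\<close>.
\<close>

definition recv_kernel ::
  "'a symbol pmf \<Rightarrow> nat \<Rightarrow> real \<Rightarrow> 'a null_laws \<Rightarrow> nat \<Rightarrow> nat \<Rightarrow> bit list \<Rightarrow>
   nat \<Rightarrow> bit list \<Rightarrow> bit list list \<Rightarrow> bit pmf" where
  "recv_kernel p m \<beta> D n i vb k v us =
     (if k \<in> I_sent p m \<beta> n i \<union> F_rand p m \<beta> n i then return_pmf (vb ! k)
      else if k \<in> F_det p \<beta> n i then law_V p D n i k v
      else law_VU p D n i k (v, us))"

text \<open>
  \<open>S r\<close> is the list of the versions, held by terminal \<open>r\<close>, of the vectors of the rounds before \<open>i\<close>.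
  \<open>Pi_pmf\<close> makes the private samplings of the receiving terminals independent of each other.
\<close>

definition protocol_round ::
  "'a symbol pmf \<Rightarrow> nat \<Rightarrow> real \<Rightarrow> 'a null_laws \<Rightarrow> nat \<Rightarrow> nat \<Rightarrow> 'a list list \<Rightarrow>
   (nat \<Rightarrow> bit list list) \<Rightarrow> (nat \<Rightarrow> bit list list) pmf" where
  "protocol_round p m \<beta> D n i xs S = (let j = i mod m in do {
     vb \<leftarrow> sequential_pmf (\<lambda>k v. gen_kernel p m \<beta> D n i k v (xs ! j) (S j)) (2 ^ n);
     vr \<leftarrow> Pi_pmf ({..m} - {j}) []
            (\<lambda>r. sequential_pmf (\<lambda>k v. recv_kernel p m \<beta> D n i vb k v (S r)) (2 ^ n));
     return_pmf (\<lambda>r. S r @ [polar n (if r = j then vb else vr r)])})"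

definition sources :: "'a symbol pmf \<Rightarrow> nat \<Rightarrow> nat \<Rightarrow> 'a list list pmf" where
  "sources p m n =
     map_pmf (\<lambda>\<omega>. map (\<lambda>j. map (\<lambda>x. x ! j) \<omega>) [0..<m]) (replicate_pmf (2 ^ n) (map_pmf fst p))"

primrec rounds ::
  "'a symbol pmf \<Rightarrow> nat \<Rightarrow> real \<Rightarrow> 'a null_laws \<Rightarrow> nat \<Rightarrow> 'a list list \<Rightarrow> nat \<Rightarrow>
   (nat \<Rightarrow> bit list list) pmf" where
  "rounds p m \<beta> D n xs 0 = return_pmf (\<lambda>r. [])"
| "rounds p m \<beta> D n xs (Suc i) =
     do {S \<leftarrow> rounds p m \<beta> D n xs i; protocol_round p m \<beta> D n i xs S}"

text \<open>
  The law of the outcome \<open>S\<close> of all \<open>t\<close> rounds: \<open>S r ! l\<close> is the vector generated (if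
  \<open>r = l mod m\<close>) or computed (otherwise) by terminal \<open>r \<le> m\<close> in round \<open>l\<close>.
\<close>

definition protocol ::
  "'a symbol pmf \<Rightarrow> nat \<Rightarrow> nat \<Rightarrow> real \<Rightarrow> 'a null_laws \<Rightarrow> nat \<Rightarrow> (nat \<Rightarrow> bit list list) pmf" where
  "protocol p m t \<beta> D n = do {xs \<leftarrow> sources p m n; rounds p m \<beta> D n xs t}"

end

theory Submission
  imports Defs "HOL-Real_Asymp.Real_Asymp"
begin

text \<open>
  No polarization theorem is needed, since the index sets are defined by the Bhattacharyya
  parameters themselves. Each bit kernel is within \<open>O(sqrt \<delta>)\<close>, on average under the ideal law
  \<open>P\<close>, of the true conditional law: on \<open>F_rand\<close> because the bit is nearly uniform, on \<open>F_det\<close>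
  because it is nearly determined by its prefix, and on \<open>I_info\<close> there is no error. By the Markov
  property the law given what the broadcaster knows is also the law given all sources, so the
  \<open>l1\<close> errors of the \<open>t * N\<close> steps add up.

  For the agreement, one runs the same telescoping argument on the sub-probability that the
  transcript is \<open>us\<close> and that all other \<open>m\<close> terminals have reproduced it. Its bit kernel is the
  broadcaster's kernel times the \<open>m\<close>-th power of the probability that a receiver draws the same
  bit. This sub-probability is close to \<open>P\<close>, so its total mass is close to 1.
\<close>

subsection \<open>The polar transform is an involution\<close>

text \<open>The obstacle is that every terminal works with its own versions of all earlier vectors.
  Once two versions differ, the law of the later rounds has no useful form. Hence the outcome of the
  protocol is never computed: its probability is only bounded below by the paths on which no
  terminal ever deviates. On such a path all versions coincide, whichever terminal broadcasts next,
  the receivers draw independently given the broadcast vector, and the probability is a product over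
  rounds and bits. The price of this lower bound is a kernel whose mass may be below 1, so the
  telescoping estimate is stated for sub-stochastic kernels; it then serves \<open>Q\<close> and the
  agreement event alike. The square root is forced only by the nearly uniform bits. It halves the
  exponent, and together with the factor \<open>N\<close> it is absorbed by the gap between
  \<open>\<beta>\<^sub>7\<close> and \<beta>. The transform has to be inverted because kernels act
  on the bits of \<open>v\<close> while transcripts record \<open>u\<close>.\<close>

lemma bit_reverse_less: "bit_reverse n i < 2 ^ n"
proof (induction n arbitrary: i)
  case (Suc n)
  have "i mod 2 \<le> 1" by simp
  then have "2 ^ n * (i mod 2) \<le> 2 ^ n * 1" by (rule mult_le_mono2)
  moreover have "bit_reverse n (i div 2) < 2 ^ n" by (rule Suc)
  ultimately show ?case unfolding bit_reverse.simps power_Suc by linarith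
qed simp

text \<open>Turns the arithmetic recursion into a statement about single binary digits, from which
  the involution property and the symmetry of the Kronecker power follow without further
  induction.\<close>

lemma bit_bit_reverse: "bit (bit_reverse n i) b \<longleftrightarrow> b < n \<and> bit i (n - 1 - b)"
proof (induction n arbitrary: i b)
  case (Suc n)
  let ?r = "bit_reverse (Suc n) i"
  have dm: "?r div 2 ^ n = i mod 2" "?r mod 2 ^ n = bit_reverse n (i div 2)"
    using bit_reverse_less[of n "i div 2"] by simp_all
  consider "b < n" | "b = n" | "n < b" by linarith
  then show ?case
  proof cases
    case 1
    then have "bit ?r b \<longleftrightarrow> bit (?r mod 2 ^ n) b"
      by (metis bit_take_bit_iff take_bit_eq_mod)
    also have "\<dots> \<longleftrightarrow> bit i (Suc (n - 1 - b))"
      unfolding dm Suc.IH bit_Suc using 1 by blast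
    also have "Suc (n - 1 - b) = Suc n - 1 - b" using 1 by simp
    finally show ?thesis using 1 by simp
  next
    case 2
    have "bit ?r n \<longleftrightarrow> odd (i mod 2)" unfolding bit_iff_odd dm ..
    then show ?thesis using 2 by (simp add: bit_0)
  next
    case 3
    have "\<not> bit ?r b"
      using bit_reverse_less[of "Suc n" i] 3 by (metis Suc_leI bit_take_bit_iff take_bit_nat_eq_self leD)
    then show ?thesis using 3 by simp
  qed
qed simp

lemma bit_reverse_involution:
  assumes "i < 2 ^ n"
  shows "bit_reverse n (bit_reverse n i) = i"
proof (rule bit_eqI)
  fix b
  have "bit i b \<Longrightarrow> b < n"
    using assms by (metis bit_take_bit_iff take_bit_nat_eq_self)
  then show "bit (bit_reverse n (bit_reverse n i)) b = bit i b"
    by (auto simp: bit_bit_reverse)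
qed

section \<open>Entries and square of the Kronecker power\<close>

lemma dim_polar_F_power [simp]:
  "dim_row (polar_F_power n) = 2 ^ n" "dim_col (polar_F_power n) = 2 ^ n"
  by (induction n) (auto simp: kronecker_def polar_F_def mat_of_rows_list_def)

lemma index_polar_F_power_Suc:
  assumes "i < 2 ^ Suc n" "j < 2 ^ Suc n"
  shows "polar_F_power (Suc n) $$ (i, j) =
    polar_F $$ (i div 2 ^ n, j div 2 ^ n) * polar_F_power n $$ (i mod 2 ^ n, j mod 2 ^ n)"
proof -
  have "dim_row polar_F = 2" "dim_col polar_F = 2"
    by (auto simp: polar_F_def mat_of_rows_list_def)
  then show ?thesis using assms by (simp add: kronecker_def)
qed

lemma index_polar_F:
  assumes "a < 2" "b < 2"
  shows "polar_F $$ (a, b) = (if odd b \<longrightarrow> odd a then 1 else 0)"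
proof -
  have "a = 0 \<or> a = 1" "b = 0 \<or> b = 1" using assms by auto
  then show ?thesis by (auto simp: polar_F_def mat_of_rows_list_def)
qed

text \<open>\<open>polar_F\<close> is the order matrix of a two-element chain, and the Kronecker
  product of order matrices belongs to the product order. Hence the power is the inclusion matrix of
  the sets of binary digits.\<close>

lemma index_polar_F_power:
  assumes "i < 2 ^ n" "j < 2 ^ n"
  shows "polar_F_power n $$ (i, j) = (if \<forall>b<n. bit j b \<longrightarrow> bit i b then 1 else 0)"
  using assms
proof (induction n arbitrary: i j)
  case (Suc n)
  have d: "i div 2 ^ n < 2" "j div 2 ^ n < 2"
    using Suc.prems by (auto simp: less_mult_imp_div_less)
  have m: "i mod 2 ^ n < 2 ^ n" "j mod 2 ^ n < 2 ^ n" by auto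
  have eq: "bit (i mod 2 ^ n) b \<longleftrightarrow> bit i b" "bit (j mod 2 ^ n) b \<longleftrightarrow> bit j b" if "b < n" for b
    using that by (metis bit_take_bit_iff take_bit_eq_mod)+
  show ?case
    unfolding index_polar_F_power_Suc[OF Suc.prems] index_polar_F[OF d] Suc.IH[OF m]
  proof -
    have "(\<forall>b<Suc n. bit j b \<longrightarrow> bit i b) \<longleftrightarrow>
        (odd (j div 2 ^ n) \<longrightarrow> odd (i div 2 ^ n)) \<and> (\<forall>b<n. bit (j mod 2 ^ n) b \<longrightarrow> bit (i mod 2 ^ n) b)"
      unfolding All_less_Suc using eq bit_iff_odd[of i n] bit_iff_odd[of j n] by blast
    then show "(if odd (j div 2 ^ n) \<longrightarrow> odd (i div 2 ^ n) then 1 else 0) *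
        (if \<forall>b<n. bit (j mod 2 ^ n) b \<longrightarrow> bit (i mod 2 ^ n) b then 1 else 0) =
        (if \<forall>b<Suc n. bit j b \<longrightarrow> bit i b then 1 else (0::bit))"
      by simp
  qed
qed auto

text \<open>Inclusion of digit sets is unchanged when the digit positions of both indices are
  permuted in the same way.\<close>

lemma polar_F_power_bit_reverse:
  assumes "i < 2 ^ n" "j < 2 ^ n"
  shows "polar_F_power n $$ (bit_reverse n i, bit_reverse n j) = polar_F_power n $$ (i, j)"
proof -
  have "(\<forall>b<n. bit (bit_reverse n j) b \<longrightarrow> bit (bit_reverse n i) b) \<longleftrightarrow> (\<forall>b<n. bit j b \<longrightarrow> bit i b)"
    (is "?L \<longleftrightarrow> ?R")
  proof
    assume L: ?L
    show ?R
    proof (intro allI impI)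
      fix b assume "b < n" "bit j b"
      then show "bit i b" using L[rule_format, of "n - 1 - b"] by (auto simp: bit_bit_reverse)
    qed
  qed (auto simp: bit_bit_reverse)
  then show ?thesis using assms by (simp add: index_polar_F_power bit_reverse_less)
qed

lemma sum_lessThan_double:
  fixes f :: "nat \<Rightarrow> 'c::comm_monoid_add"
  shows "(\<Sum>k<2 * N. f k) = (\<Sum>k<N. f k) + (\<Sum>k<N. f (N + k))"
proof -
  have "(\<Sum>k<2 * N. f k) = sum f {0..<N} + sum f {0 + N..<N + N}"
    by (simp add: mult_2 lessThan_atLeast0 sum.atLeastLessThan_concat)
  then show ?thesis
    unfolding sum.shift_bounds_nat_ivl lessThan_atLeast0 by (simp only: add.commute)
qed

lemma polar_F_power_square:
  assumes "i < 2 ^ n" "j < 2 ^ n"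
  shows "(\<Sum>k<2 ^ n. polar_F_power n $$ (i, k) * polar_F_power n $$ (k, j)) = (if i = j then 1 else 0)"
  using assms
proof (induction n arbitrary: i j)
  case (Suc n)
  let ?F = "polar_F_power n" and ?i = "i mod 2 ^ n" and ?j = "j mod 2 ^ n"
  let ?f = "\<lambda>a b. polar_F $$ (a, b)" and ?a = "i div 2 ^ n" and ?b = "j div 2 ^ n"
  have d: "?a < 2" "?b < 2"
    using Suc.prems by (auto simp: less_mult_imp_div_less)
  have IH: "(\<Sum>k<2 ^ n. ?F $$ (?i, k) * ?F $$ (k, ?j)) = (if ?i = ?j then 1 else 0)"
    by (rule Suc.IH) auto
  \<comment> \<open>The middle index is split by its leading digit: the first sum has digit 0, the
    second has digit 1.\<close>
  have "(\<Sum>k<2 ^ Suc n. polar_F_power (Suc n) $$ (i, k) * polar_F_power (Suc n) $$ (k, j)) =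
      (\<Sum>k<2 ^ n. (?f ?a 0 * ?F $$ (?i, k)) * (?f 0 ?b * ?F $$ (k, ?j))) +
      (\<Sum>k<2 ^ n. (?f ?a 1 * ?F $$ (?i, k)) * (?f 1 ?b * ?F $$ (k, ?j)))"
    unfolding power_Suc sum_lessThan_double
  proof (intro arg_cong2[of _ _ _ _ "(+)"] sum.cong refl)
    fix k :: nat assume "k \<in> {..<2 ^ n}"
    then have k: "k < 2 ^ Suc n" "k div 2 ^ n = 0" "k mod 2 ^ n = k"
      and k': "2 ^ n + k < 2 ^ Suc n" "(2 ^ n + k) div 2 ^ n = 1" "(2 ^ n + k) mod 2 ^ n = k"
      by auto
    show "polar_F_power (Suc n) $$ (i, k) * polar_F_power (Suc n) $$ (k, j) =
        (?f ?a 0 * ?F $$ (?i, k)) * (?f 0 ?b * ?F $$ (k, ?j))"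
      using Suc.prems k by (simp only: index_polar_F_power_Suc)
    show "polar_F_power (Suc n) $$ (i, 2 ^ n + k) * polar_F_power (Suc n) $$ (2 ^ n + k, j) =
        (?f ?a 1 * ?F $$ (?i, k)) * (?f 1 ?b * ?F $$ (k, ?j))"
      using Suc.prems k' by (simp only: index_polar_F_power_Suc)
  qed
  also have "\<dots> = (?f ?a 0 * ?f 0 ?b + ?f ?a 1 * ?f 1 ?b) * (if ?i = ?j then 1 else 0)"
    unfolding IH[symmetric] distrib_right sum_distrib_left sum.distrib by (intro arg_cong2[of _ _ _ _ "(+)"] sum.cong refl) (simp_all only: ac_simps)
  \<comment> \<open>The two-by-two case: \<open>polar_F\<close> squares to the identity because 1 +
    1 = 0 in \<open>bit\<close>.\<close>
  also have "?f ?a 0 * ?f 0 ?b + ?f ?a 1 * ?f 1 ?b = (if ?a = ?b then 1 else 0)"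
  proof -
    have "?a = 0 \<or> ?a = 1" "?b = 0 \<or> ?b = 1" using d by auto
    then show ?thesis by (elim disjE) (simp_all only: index_polar_F, simp_all)
  qed
  also have "\<dots> * (if ?i = ?j then 1 else 0) = (if i = j then 1 else 0)"
  proof -
    have "i = j \<longleftrightarrow> ?a = ?b \<and> ?i = ?j"
      by (metis div_mult_mod_eq)
    then show ?thesis by simp
  qed
  finally show ?case .
qed auto

lemma index_polar_G:
  assumes "i < 2 ^ n" "j < 2 ^ n"
  shows "polar_G n $$ (i, j) = polar_F_power n $$ (bit_reverse n i, j)"
proof -
  have "polar_G n $$ (i, j) =
      (\<Sum>k = 0..<2 ^ n. (if k = bit_reverse n i then 1 else 0) * polar_F_power n $$ (k, j))"
    using assms by (simp add: polar_G_def bit_reversal_mat_def scalar_prod_def)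
  also have "\<dots> = (\<Sum>k = 0..<2 ^ n. if k = bit_reverse n i then polar_F_power n $$ (k, j) else 0)"
    by (intro sum.cong) auto
  finally show ?thesis by (simp add: bit_reverse_less)
qed

lemma polar_G_carrier [simp]: "polar_G n \<in> carrier_mat (2 ^ n) (2 ^ n)"
  unfolding polar_G_def bit_reversal_mat_def carrier_mat_def by (simp del: One_nat_def)

lemma dim_polar_G: "dim_row (polar_G n) = 2 ^ n" "dim_col (polar_G n) = 2 ^ n"
  using carrier_matD[OF polar_G_carrier] by auto

text \<open>The bit reversal of the left factor is moved from its row index to its column index by
  symmetry. Both factors then see the reversed middle index, and summing over it is the same as
  summing over \<open>k\<close>; what remains is the square of the Kronecker power.\<close>

lemma polar_G_square: "polar_G n * polar_G n = 1\<^sub>m (2 ^ n)"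
proof (rule eq_matI)
  fix i j assume "i < dim_row (1\<^sub>m (2 ^ n))" "j < dim_col (1\<^sub>m (2 ^ n))"
  then have ij: "i < 2 ^ n" "j < 2 ^ n" by auto
  have "(polar_G n * polar_G n) $$ (i, j) = (\<Sum>k<2 ^ n. polar_G n $$ (i, k) * polar_G n $$ (k, j))"
    using ij by (simp add: dim_polar_G scalar_prod_def lessThan_atLeast0)
  also have "\<dots> = (\<Sum>k<2 ^ n. polar_F_power n $$ (i, bit_reverse n k) * polar_F_power n $$ (bit_reverse n k, j))"
  proof (intro sum.cong refl)
    fix k :: nat assume "k \<in> {..<2 ^ n}"
    then have "k < 2 ^ n" by simp
    then show "polar_G n $$ (i, k) * polar_G n $$ (k, j) =
        polar_F_power n $$ (i, bit_reverse n k) * polar_F_power n $$ (bit_reverse n k, j)"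
      using ij polar_F_power_bit_reverse[OF ij(1) bit_reverse_less[of n k]]
      by (simp only: index_polar_G bit_reverse_involution)
  qed
  also have "\<dots> = (\<Sum>k<2 ^ n. polar_F_power n $$ (i, k) * polar_F_power n $$ (k, j))"
    by (rule sum.reindex_bij_witness[of _ "bit_reverse n" "bit_reverse n"])
      (auto simp: bit_reverse_involution bit_reverse_less)
  also have "\<dots> = 1\<^sub>m (2 ^ n) $$ (i, j)"
    using ij by (simp only: polar_F_power_square index_one_mat)
  finally show "(polar_G n * polar_G n) $$ (i, j) = 1\<^sub>m (2 ^ n) $$ (i, j)" .
qed (simp_all add: dim_polar_G)

lemma length_polar [simp]: "length (polar n u) = 2 ^ n"
  using carrier_matD(2)[OF polar_G_carrier[of n]] by (simp add: polar_def)

text \<open>Makes \<open>polar n\<close> a bijection of the lists of length \<open>2 ^ n\<close>, so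
  that sums over transcripts may be taken over \<open>u\<close> or over \<open>v\<close> at
  will.\<close>

lemma polar_polar:
  assumes "length u = 2 ^ n"
  shows "polar n (polar n u) = u"
proof -
  let ?T = "transpose_mat (polar_G n)" and ?u = "vec_of_list u"
  have T: "?T \<in> carrier_mat (2 ^ n) (2 ^ n)" by (simp only: transpose_carrier_mat polar_G_carrier)
  have u: "?u \<in> carrier_vec (2 ^ n)"
    using assms by (intro carrier_vecI) simp
  have "polar n (polar n u) = list_of_vec (?T *\<^sub>v (?T *\<^sub>v ?u))"
    unfolding polar_def vec_list ..
  also have "?T *\<^sub>v (?T *\<^sub>v ?u) = (?T * ?T) *\<^sub>v ?u"
    by (rule assoc_mult_mat_vec[OF T T u, symmetric])
  also have "?T * ?T = transpose_mat (polar_G n * polar_G n)"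
    by (rule transpose_mult[OF polar_G_carrier polar_G_carrier, symmetric])
  also have "\<dots> = 1\<^sub>m (2 ^ n)"
    unfolding polar_G_square transpose_one ..
  also have "1\<^sub>m (2 ^ n) *\<^sub>v ?u = ?u" by (rule one_mult_mat_vec[OF u])
  finally show ?thesis unfolding list_vec .
qed

subsection \<open>Bhattacharyya parameters and errors of one bit\<close>

lemma bit_eq_0_or_1: "b = 0 \<or> b = (1 :: bit)"
  by (cases b) simp_all

lemma UNIV_bit: "(UNIV :: bit set) = {0, 1}"
  using bit_eq_0_or_1 by blast

lemma sum_UNIV_bit: "(\<Sum>b\<in>(UNIV :: bit set). f b) = f 0 + f 1"
  unfolding UNIV_bit by simp

section \<open>Finite averages and conditional probabilities\<close>

definition mean :: "'s pmf \<Rightarrow> ('s \<Rightarrow> real) \<Rightarrow> real" where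
  "mean q f = (\<Sum>\<omega>\<in>set_pmf q. pmf q \<omega> * f \<omega>)"

text \<open>The conditioning value is given through an outcome \<open>\<omega>\<close> that attains
  it. Averages then run over \<open>q\<close> directly, and on the support the denominator is never
  0.\<close>

definition cprob :: "'s pmf \<Rightarrow> ('s \<Rightarrow> 'c) \<Rightarrow> ('s \<Rightarrow> 'b) \<Rightarrow> 's \<Rightarrow> 'c \<Rightarrow> real" where
  "cprob q T B \<omega> b = measure q {\<omega>'. T \<omega>' = b \<and> B \<omega>' = B \<omega>} / measure q {\<omega>'. B \<omega>' = B \<omega>}"

lemma mean_mono: "(\<And>\<omega>. \<omega> \<in> set_pmf q \<Longrightarrow> f \<omega> \<le> g \<omega>) \<Longrightarrow> mean q f \<le> mean q g"
  unfolding mean_def by (intro sum_mono mult_left_mono) auto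

lemma mean_cong: "(\<And>\<omega>. \<omega> \<in> set_pmf q \<Longrightarrow> f \<omega> = g \<omega>) \<Longrightarrow> mean q f = mean q g"
  unfolding mean_def by (intro sum.cong) auto

lemma mean_add: "mean q (\<lambda>\<omega>. f \<omega> + g \<omega>) = mean q f + mean q g"
  unfolding mean_def by (simp add: distrib_left sum.distrib)

lemma mean_cmult: "mean q (\<lambda>\<omega>. c * f \<omega>) = c * mean q f"
  unfolding mean_def by (simp add: sum_distrib_left mult.left_commute)

lemma mean_const: "finite (set_pmf q) \<Longrightarrow> mean q (\<lambda>_. c) = c"
  unfolding mean_def by (simp add: sum_distrib_right[symmetric] sum_pmf_eq_1)

lemma measure_eq_mean:
  assumes "finite (set_pmf q)"
  shows "measure q {\<omega>. P \<omega>} = mean q (\<lambda>\<omega>. of_bool (P \<omega>))"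
proof -
  have "measure q {\<omega>. P \<omega>} = sum (pmf q) ({\<omega>. P \<omega>} \<inter> set_pmf q)"
    using assms by (subst measure_Int_set_pmf[symmetric]) (simp add: measure_measure_pmf_finite)
  also have "\<dots> = mean q (\<lambda>\<omega>. of_bool (P \<omega>))"
    unfolding mean_def using assms by (intro sum.mono_neutral_cong_left) auto
  finally show ?thesis .
qed

lemma mean_by_value:
  assumes "finite (set_pmf q)"
  shows "mean q f = (\<Sum>y\<in>B ` set_pmf q. mean q (\<lambda>\<omega>. of_bool (B \<omega> = y) * f \<omega>))"
proof -
  have "mean q f = (\<Sum>y\<in>B ` set_pmf q. \<Sum>\<omega>\<in>{\<omega> \<in> set_pmf q. B \<omega> = y}. pmf q \<omega> * f \<omega>)"
    unfolding mean_def using assms by (rule sum.image_gen)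
  also have "\<dots> = (\<Sum>y\<in>B ` set_pmf q. mean q (\<lambda>\<omega>. of_bool (B \<omega> = y) * f \<omega>))"
    unfolding mean_def using assms by (intro sum.cong refl sum.mono_neutral_cong_left) auto
  finally show ?thesis .
qed

lemma measure_fiber_pos: "\<omega> \<in> set_pmf q \<Longrightarrow> measure q {\<omega>'. B \<omega>' = B \<omega>} > 0"
  by (rule measure_pmf_posI) auto

lemma cprob_nonneg: "cprob q T B \<omega> b \<ge> 0"
  by (simp add: cprob_def)

lemma cprob_sum:
  assumes "\<omega> \<in> set_pmf q"
  shows "cprob q T B \<omega> 0 + cprob q T B \<omega> (1 :: bit) = 1"
proof -
  have "measure q {\<omega>'. B \<omega>' = B \<omega>} =
      measure q ({\<omega>'. T \<omega>' = 0 \<and> B \<omega>' = B \<omega>} \<union> {\<omega>'. T \<omega>' = 1 \<and> B \<omega>' = B \<omega>})"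
    by (rule arg_cong[of _ _ "measure q"]) (use bit_eq_0_or_1 in blast)
  also have "\<dots> = measure q {\<omega>'. T \<omega>' = 0 \<and> B \<omega>' = B \<omega>} + measure q {\<omega>'. T \<omega>' = 1 \<and> B \<omega>' = B \<omega>}"
    by (rule measure_pmf.finite_measure_Union) auto
  finally show ?thesis
    using measure_fiber_pos[OF assms, of B] by (simp add: cprob_def add_divide_distrib[symmetric])
qed

lemma cprob_cong:
  assumes "\<And>\<omega>'. \<omega>' \<in> set_pmf q \<Longrightarrow> B \<omega>' = B \<omega> \<longleftrightarrow> C \<omega>' = C \<omega>"
  shows "cprob q T B \<omega> b = cprob q T C \<omega> b"
proof -
  have "measure q {\<omega>'. T \<omega>' = b \<and> B \<omega>' = B \<omega>} = measure q {\<omega>'. T \<omega>' = b \<and> C \<omega>' = C \<omega>}"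
    "measure q {\<omega>'. B \<omega>' = B \<omega>} = measure q {\<omega>'. C \<omega>' = C \<omega>}"
    using assms by (auto intro!: measure_eq_AE simp: AE_measure_pmf_iff)
  then show ?thesis by (simp add: cprob_def)
qed

text \<open>The tower property: \<open>h\<close> is determined by \<open>B\<close>, so it is
  constant on each fiber of \<open>B\<close> and can be taken out of the average over that
  fiber.\<close>

lemma mean_cprob:
  assumes "finite (set_pmf q)" "\<And>\<omega> \<omega>'. \<omega> \<in> set_pmf q \<Longrightarrow> \<omega>' \<in> set_pmf q \<Longrightarrow> B \<omega> = B \<omega>' \<Longrightarrow> h \<omega> = h \<omega>'"
  shows "mean q (\<lambda>\<omega>. cprob q T B \<omega> b * h \<omega>) = mean q (\<lambda>\<omega>. of_bool (T \<omega> = b) * h \<omega>)"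
proof -
  have "mean q (\<lambda>\<omega>. of_bool (B \<omega> = y) * (cprob q T B \<omega> b * h \<omega>)) =
      mean q (\<lambda>\<omega>. of_bool (B \<omega> = y) * (of_bool (T \<omega> = b) * h \<omega>))" if "y \<in> B ` set_pmf q" for y
  proof -
  from that obtain \<omega>0 where w: "\<omega>0 \<in> set_pmf q" "y = B \<omega>0" by auto
  have h: "h \<omega> - h \<omega>0 = 0" if "\<omega> \<in> set_pmf q" "B \<omega> = B \<omega>0" for \<omega>
    using assms(2)[OF that(1) w(1) that(2)] by simp
  let ?m = "measure q {\<omega>'. B \<omega>' = B \<omega>0}" and ?c = "cprob q T B \<omega>0 b"
  have "mean q (\<lambda>\<omega>. of_bool (B \<omega> = y) * (cprob q T B \<omega> b * h \<omega>)) = mean q (\<lambda>\<omega>. (?c * h \<omega>0) * of_bool (B \<omega> = B \<omega>0))"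
    by (intro mean_cong) (use h in \<open>auto simp: cprob_def w(2)\<close>)
  also have "\<dots> = ?c * h \<omega>0 * ?m"
    by (simp only: mean_cmult measure_eq_mean[OF assms(1)])
  also have "\<dots> = h \<omega>0 * measure q {\<omega>'. T \<omega>' = b \<and> B \<omega>' = B \<omega>0}"
    using measure_fiber_pos[OF w(1), of B] by (simp add: cprob_def)
  also have "\<dots> = mean q (\<lambda>\<omega>. of_bool (B \<omega> = y) * (of_bool (T \<omega> = b) * h \<omega>))"
    unfolding measure_eq_mean[OF assms(1)] mean_cmult[symmetric]
    by (intro mean_cong) (use h in \<open>auto simp: w(2)\<close>)
  finally show ?thesis .
  qed
  then show ?thesis
    unfolding mean_by_value[OF assms(1), where B = B and f = "\<lambda>\<omega>. cprob q T B \<omega> b * h \<omega>"]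
      mean_by_value[OF assms(1), where B = B and f = "\<lambda>\<omega>. of_bool (T \<omega> = b) * h \<omega>"]
    by (intro sum.cong refl)
qed

text \<open>Outside the image of the support the weight of a value is 0, so the infinite sum is
  finite and the default values of the conditional probabilities there are multiplied by 0.\<close>

lemma bhattacharyya_eq_mean:
  assumes "finite (set_pmf q)"
  shows "bhattacharyya q T B = mean q (\<lambda>\<omega>. 2 * sqrt (cprob q T B \<omega> 0 * cprob q T B \<omega> 1))"
proof -
  let ?S = "B ` set_pmf q"
  let ?c = "\<lambda>v b. measure q {\<omega>. T \<omega> = b \<and> B \<omega> = v} / measure q {\<omega>. B \<omega> = v}"
  let ?s = "\<lambda>v. sqrt (?c v 0 * ?c v 1)"
  have "bhattacharyya q T B = 2 * (\<Sum>\<^sub>\<infinity>v. measure q {\<omega>. B \<omega> = v} * ?s v)"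
    by (simp only: bhattacharyya_def cond_prob_def space_measure_pmf UNIV_I simp_thms)
  also have "(\<Sum>\<^sub>\<infinity>v. measure q {\<omega>. B \<omega> = v} * ?s v) = (\<Sum>\<^sub>\<infinity>v\<in>?S. measure q {\<omega>. B \<omega> = v} * ?s v)"
  proof (rule infsum_cong_neutral)
    fix v assume "v \<in> UNIV - ?S"
    then have "measure q {\<omega>. B \<omega> = v} = 0"
      by (subst measure_pmf_zero_iff) auto
    then show "measure q {\<omega>. B \<omega> = v} * ?s v = 0" by simp
  qed auto
  also have "\<dots> = (\<Sum>v\<in>?S. measure q {\<omega>. B \<omega> = v} * ?s v)"
    using assms by simp
  also have "\<dots> = (\<Sum>v\<in>?S. mean q (\<lambda>\<omega>. of_bool (B \<omega> = v) * sqrt (cprob q T B \<omega> 0 * cprob q T B \<omega> 1)))"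
  proof (rule sum.cong[OF refl])
    fix v
    have "measure q {\<omega>. B \<omega> = v} * ?s v = mean q (\<lambda>\<omega>. ?s v * of_bool (B \<omega> = v))"
      unfolding mean_cmult measure_eq_mean[OF assms, of "\<lambda>\<omega>. B \<omega> = v", symmetric] by (rule mult.commute)
    also have "\<dots> = mean q (\<lambda>\<omega>. of_bool (B \<omega> = v) * sqrt (cprob q T B \<omega> 0 * cprob q T B \<omega> 1))"
      by (intro mean_cong) (auto simp: cprob_def)
    finally show "measure q {\<omega>. B \<omega> = v} * ?s v = mean q (\<lambda>\<omega>. of_bool (B \<omega> = v) * sqrt (cprob q T B \<omega> 0 * cprob q T B \<omega> 1))" .
  qed
  also have "\<dots> = mean q (\<lambda>\<omega>. sqrt (cprob q T B \<omega> 0 * cprob q T B \<omega> 1))"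
    by (rule mean_by_value[OF assms, symmetric])
  finally show ?thesis by (simp only: mean_cmult)
qed

text \<open>Only the partition generated by the conditioning variable matters. The index sets
  condition on a list of tuples, one per symbol, while the kernels condition on a tuple of vectors;
  this lemma passes between the two encodings.\<close>

lemma bhattacharyya_cong:
  assumes "finite (set_pmf q)"
    "\<And>\<omega> \<omega>'. \<omega> \<in> set_pmf q \<Longrightarrow> \<omega>' \<in> set_pmf q \<Longrightarrow> B \<omega>' = B \<omega> \<longleftrightarrow> C \<omega>' = C \<omega>"
  shows "bhattacharyya q T B = bhattacharyya q T C"
  unfolding bhattacharyya_eq_mean[OF assms(1)]
proof (rule mean_cong)
  fix \<omega> assume "\<omega> \<in> set_pmf q"
  then have "cprob q T B \<omega> b = cprob q T C \<omega> b" for b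
    using assms(2) by (intro cprob_cong) blast
  then show "2 * sqrt (cprob q T B \<omega> 0 * cprob q T B \<omega> 1) = 2 * sqrt (cprob q T C \<omega> 0 * cprob q T C \<omega> 1)"
    by simp
qed

text \<open>With \<open>s = 2 sqrt (c0 c1)\<close> one has \<open>(1 - 2 c0)\<^sup>2 = (1 - s) (1 + s) \<le> 2 (1 - s)\<close>; Jensen's
  inequality for the square root is replaced by \<open>y \<le> (y\<^sup>2 / r + r) / 2\<close> with \<open>r = sqrt (2 d)\<close>.\<close>

lemma uniform_bit_error:
  assumes "finite (set_pmf q)" "bhattacharyya q T B \<ge> 1 - d" "d > 0"
  shows "mean q (\<lambda>\<omega>. \<Sum>b\<in>UNIV. \<bar>1 / 2 - cprob q T B \<omega> b\<bar>) \<le> sqrt (2 * d)"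
proof -
  let ?s = "\<lambda>\<omega>. 2 * sqrt (cprob q T B \<omega> 0 * cprob q T B \<omega> 1)"
  define r where "r = sqrt (2 * d)"
  have r: "r > 0" "r * r = 2 * d" using assms by (auto simp: r_def)
  have "mean q (\<lambda>\<omega>. \<Sum>b\<in>UNIV. \<bar>1 / 2 - cprob q T B \<omega> b\<bar>) \<le> mean q (\<lambda>\<omega>. (1 / r + r / 2) + (- 1 / r) * ?s \<omega>)"
  proof (rule mean_mono)
    fix \<omega> assume w: "\<omega> \<in> set_pmf q"
    define c where "c = cprob q T B \<omega> 0"
    have c1: "cprob q T B \<omega> 1 = 1 - c" using cprob_sum[OF w, of T B] by (simp add: c_def)
    have c: "0 \<le> c" "c \<le> 1" using cprob_nonneg[of q T B \<omega> 0] cprob_nonneg[of q T B \<omega> 1] c1 by (auto simp: c_def)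
    define s where "s = 2 * sqrt (c * (1 - c))"
    have s: "s * s = 4 * (c * (1 - c))" "s \<ge> 0" using c by (auto simp: s_def)
    have "(2 * c - 1) * (2 * c - 1) = 1 - s * s" unfolding s by (simp add: algebra_simps)
    then have "s * s \<le> 1" using zero_le_square[of "2 * c - 1"] by linarith
    then have s1: "s \<le> 1" using s(2) by (metis abs_of_nonneg abs_square_le_1 power2_eq_square)
    define y where "y = \<bar>1 - 2 * c\<bar>"
    have y: "y * y = (1 - s) * (1 + s)" unfolding y_def abs_mult_self_eq using s(1) by (simp add: algebra_simps)
    have "(1 - s) * (1 + s) \<le> (1 - s) * 2" using s s1 by (intro mult_left_mono) auto
    then have y2: "y * y \<le> 2 * (1 - s)" using y by simp
    have "0 \<le> (y - r) * (y - r)" by simp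
    then have "2 * y * r \<le> 2 * (1 - s) + r * r" using y2 by (simp add: algebra_simps)
    then have "y \<le> (2 * (1 - s) + r * r) / (2 * r)" using r by (simp add: field_simps)
    also have "\<dots> = (1 / r + r / 2) + (- 1 / r) * s" using r(1) by (simp add: field_simps)
    finally show "(\<Sum>b\<in>UNIV. \<bar>1 / 2 - cprob q T B \<omega> b\<bar>) \<le> (1 / r + r / 2) + (- 1 / r) * ?s \<omega>"
      unfolding sum_UNIV_bit c1 c_def[symmetric] s_def y_def by (simp add: abs_if split: if_splits)
  qed
  also have "\<dots> = (1 / r + r / 2) + (- 1 / r) * bhattacharyya q T B"
    unfolding mean_add mean_cmult mean_const[OF assms(1)] bhattacharyya_eq_mean[OF assms(1)] ..
  also have "\<dots> \<le> (1 / r + r / 2) + (- 1 / r) * (1 - d)"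
    using assms(2) r by (intro add_left_mono mult_left_mono_neg) auto
  also have "\<dots> = (2 * d + r * r) / (2 * r)" using r(1) by (simp add: field_simps)
  also have "\<dots> = r" using r by (simp add: field_simps)
  finally show ?thesis by (simp add: r_def)
qed

text \<open>The left side is the probability that two bits differ when one is drawn from the fine
  conditional law and the other, independently, from the coarse one. As \<open>A\<close> is
  determined by \<open>B\<close>, on average the fine law may be replaced by the coarse one, which
  leaves the mean of \<open>2 a (1 - a)\<close>.\<close>

lemma cross_bit_error:
  assumes "finite (set_pmf q)"
    and "\<And>\<omega> \<omega>'. \<omega> \<in> set_pmf q \<Longrightarrow> \<omega>' \<in> set_pmf q \<Longrightarrow> B \<omega> = B \<omega>' \<Longrightarrow> A \<omega> = A \<omega>'"
  shows "mean q (\<lambda>\<omega>. \<Sum>b\<in>UNIV. cprob q T B \<omega> b * (1 - cprob q T A \<omega> b)) \<le> bhattacharyya q T A / 2"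
proof -
  let ?t = "cprob q T B" and ?a = "cprob q T A"
  have A: "?a \<omega> b = ?a \<omega>' b" if "A \<omega> = A \<omega>'" for \<omega> \<omega>' b using that by (simp add: cprob_def)
  \<comment> \<open>The tower property is used twice, through the indicator of
    \<open>T \<omega> = b\<close>: first it removes the fine law, then it introduces the coarse
    one.\<close>
  have swap: "mean q (\<lambda>\<omega>. ?t \<omega> b * ?a \<omega> b') = mean q (\<lambda>\<omega>. ?a \<omega> b * ?a \<omega> b')" for b b'
  proof -
    have "mean q (\<lambda>\<omega>. ?t \<omega> b * ?a \<omega> b') = mean q (\<lambda>\<omega>. of_bool (T \<omega> = b) * ?a \<omega> b')"
      by (rule mean_cprob[OF assms(1)]) (rule A[OF assms(2)])
    also have "\<dots> = mean q (\<lambda>\<omega>. ?a \<omega> b * ?a \<omega> b')"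
      by (rule mean_cprob[OF assms(1), symmetric]) (rule A)
    finally show ?thesis .
  qed
  have "mean q (\<lambda>\<omega>. \<Sum>b\<in>UNIV. ?t \<omega> b * (1 - ?a \<omega> b)) = mean q (\<lambda>\<omega>. ?t \<omega> 0 * ?a \<omega> 1 + ?t \<omega> 1 * ?a \<omega> 0)"
  proof (rule mean_cong)
    fix \<omega> assume "\<omega> \<in> set_pmf q"
    from cprob_sum[OF this, of T A] have "1 - ?a \<omega> 0 = ?a \<omega> 1" "1 - ?a \<omega> 1 = ?a \<omega> 0" by auto
    then show "(\<Sum>b\<in>UNIV. ?t \<omega> b * (1 - ?a \<omega> b)) = ?t \<omega> 0 * ?a \<omega> 1 + ?t \<omega> 1 * ?a \<omega> 0"
      unfolding sum_UNIV_bit by simp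
  qed
  also have "\<dots> = mean q (\<lambda>\<omega>. 2 * (?a \<omega> 0 * ?a \<omega> 1))"
    unfolding mean_add swap mean_cmult by (simp add: mult.commute)
  \<comment> \<open>For \<open>s = sqrt (c * (1 - c))\<close> one has \<open>s \<le> 1 / 2\<close>,
    hence \<open>2 * (s * s) \<le> s\<close>.\<close>
  also have "\<dots> \<le> mean q (\<lambda>\<omega>. sqrt (?a \<omega> 0 * ?a \<omega> 1))"
  proof (rule mean_mono)
    fix \<omega> assume w: "\<omega> \<in> set_pmf q"
    define c where "c = ?a \<omega> 0"
    have c1: "?a \<omega> 1 = 1 - c" using cprob_sum[OF w, of T A] by (simp add: c_def)
    have c: "0 \<le> c" "c \<le> 1" using cprob_nonneg[of q T A \<omega> 0] cprob_nonneg[of q T A \<omega> 1] c1 by (auto simp: c_def)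
    define s where "s = sqrt (c * (1 - c))"
    have s: "s * s = c * (1 - c)" "s \<ge> 0" using c by (auto simp: s_def)
    have "c * (1 - c) \<le> (1 / 2) * (1 / 2)" using zero_le_square[of "c - 1 / 2"] by (simp add: algebra_simps)
    then have "s \<le> 1 / 2" unfolding s_def by (intro real_le_lsqrt) (use c in \<open>auto simp: power2_eq_square\<close>)
    then have "s * s \<le> (1 / 2) * s" using s(2) by (intro mult_right_mono)
    then show "2 * (?a \<omega> 0 * ?a \<omega> 1) \<le> sqrt (?a \<omega> 0 * ?a \<omega> 1)"
      unfolding c1 c_def[symmetric] s_def[symmetric] s(1)[symmetric] by simp
  qed
  also have "\<dots> = bhattacharyya q T A / 2"
    unfolding bhattacharyya_eq_mean[OF assms(1)] mean_cmult by simp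
  finally show ?thesis .
qed

text \<open>Two laws on bits differ by no more than the probability that independent draws from them
  disagree: \<open>a - t = a (1 - t) - t (1 - a)\<close>. The \<open>l1\<close> distance counts this
  difference once per bit value, and the factor 2 cancels the half in
  \<open>cross_bit_error\<close>.\<close>

lemma coarse_bit_error:
  assumes "finite (set_pmf q)"
    and "\<And>\<omega> \<omega>'. \<omega> \<in> set_pmf q \<Longrightarrow> \<omega>' \<in> set_pmf q \<Longrightarrow> B \<omega> = B \<omega>' \<Longrightarrow> A \<omega> = A \<omega>'"
  shows "mean q (\<lambda>\<omega>. \<Sum>b\<in>UNIV. \<bar>cprob q T A \<omega> b - cprob q T B \<omega> b\<bar>) \<le> bhattacharyya q T A"
proof -
  let ?t = "cprob q T B" and ?a = "cprob q T A"
  have "mean q (\<lambda>\<omega>. \<Sum>b\<in>UNIV. \<bar>?a \<omega> b - ?t \<omega> b\<bar>) \<le> mean q (\<lambda>\<omega>. 2 * (\<Sum>b\<in>UNIV. ?t \<omega> b * (1 - ?a \<omega> b)))"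
  proof (rule mean_mono)
    fix \<omega> assume w: "\<omega> \<in> set_pmf q"
    define a t where "a = ?a \<omega> 0" and "t = ?t \<omega> 0"
    have 1: "?a \<omega> 1 = 1 - a" "?t \<omega> 1 = 1 - t" using cprob_sum[OF w, of T] by (auto simp: a_def t_def algebra_simps)
    have at: "0 \<le> a" "a \<le> 1" "0 \<le> t" "t \<le> 1"
      using cprob_nonneg[of q T A \<omega> 0] cprob_nonneg[of q T A \<omega> 1] cprob_nonneg[of q T B \<omega> 0] cprob_nonneg[of q T B \<omega> 1] 1
      by (auto simp: a_def t_def)
    have "0 \<le> a * (1 - t)" "0 \<le> t * (1 - a)" using at by auto
    moreover have "a - t = a * (1 - t) - t * (1 - a)" by (simp add: algebra_simps)
    ultimately have le: "\<bar>a - t\<bar> \<le> a * (1 - t) + t * (1 - a)" by linarith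
    have eq: "\<bar>1 - a - (1 - t)\<bar> = \<bar>a - t\<bar>"
      "2 * (t * (1 - a) + (1 - t) * (1 - (1 - a))) = 2 * (a * (1 - t) + t * (1 - a))"
      by (simp_all add: algebra_simps)
    have add_le: "x \<le> R \<Longrightarrow> y = x \<Longrightarrow> S = 2 * R \<Longrightarrow> x + y \<le> S" for x y R S :: real
      by simp
    show "(\<Sum>b\<in>UNIV. \<bar>?a \<omega> b - ?t \<omega> b\<bar>) \<le> 2 * (\<Sum>b\<in>UNIV. ?t \<omega> b * (1 - ?a \<omega> b))"
      unfolding sum_UNIV_bit 1 a_def[symmetric] t_def[symmetric] by (rule add_le[OF le eq])
  qed
  also have "\<dots> \<le> bhattacharyya q T A"
  proof -
    have "mean q (\<lambda>\<omega>. \<Sum>b\<in>UNIV. ?t \<omega> b * (1 - ?a \<omega> b)) \<le> bhattacharyya q T A / 2"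
      using assms by (rule cross_bit_error)
    then show ?thesis unfolding mean_cmult by linarith
  qed
  finally show ?thesis .
qed

subsection \<open>Errors of one round\<close>

lemma pmf_replicate_pmf:
  assumes "length ys = n"
  shows "pmf (replicate_pmf n p) ys = (\<Prod>k<n. pmf p (ys ! k))"
  using assms
proof (induction n arbitrary: ys)
  case (Suc n)
  then obtain y ys' where ys: "ys = y # ys'" "length ys' = n" by (cases ys) auto
  have "replicate_pmf (Suc n) p = map_pmf (\<lambda>(x, xs). x # xs) (pair_pmf p (replicate_pmf n p))"
    by (simp add: pair_pmf_def map_bind_pmf)
  moreover have "pmf (map_pmf (\<lambda>(x, xs). x # xs) (pair_pmf p (replicate_pmf n p))) ((\<lambda>(x, xs). x # xs) (y, ys')) =
      pmf (pair_pmf p (replicate_pmf n p)) (y, ys')"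
    by (rule pmf_map_inj') (auto simp: inj_on_def)
  ultimately show ?case
    by (simp add: ys pmf_pair Suc.IH prod.lessThan_Suc_shift del: prod.lessThan_Suc)
qed simp

lemma map_replicate_pmf: "map_pmf (map g) (replicate_pmf n p) = replicate_pmf n (map_pmf g p)"
proof (induction n)
  case (Suc n)
  show ?case
    by (simp add: map_bind_pmf bind_map_pmf Suc.IH[symmetric])
qed simp

lemma measure_map_replicate_pmf:
  assumes "length ys = n"
  shows "measure (replicate_pmf n p) {\<omega>. map g \<omega> = ys} = (\<Prod>k<n. measure p {x. g x = ys ! k})"
proof -
  have "measure (replicate_pmf n p) {\<omega>. map g \<omega> = ys} = pmf (map_pmf (map g) (replicate_pmf n p)) ys"
    by (simp add: pmf_map vimage_def)
  also have "\<dots> = (\<Prod>k<n. measure p {x. g x = ys ! k})"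
    unfolding map_replicate_pmf pmf_replicate_pmf[OF assms] by (simp add: pmf_map vimage_def)
  finally show ?thesis .
qed

lemma finite_set_replicate_pmf: "finite (set_pmf p) \<Longrightarrow> finite (set_pmf (replicate_pmf n p))"
  using finite_lists_length_eq[of "set_pmf p" n] by (simp add: set_replicate_pmf lists_eq_set conj_commute)

lemma finite_bit_lists: "finite {v :: bit list. length v = n}"
proof -
  have "finite (UNIV :: bit set)" unfolding UNIV_bit by simp
  from finite_lists_length_eq[OF this, of n] show ?thesis by simp
qed

lemma sum_bit_lists_Suc:
  fixes F :: "bit list \<Rightarrow> real"
  shows "(\<Sum>v | length v = Suc n. F v) = (\<Sum>v | length v = n. \<Sum>b\<in>UNIV. F (v @ [b]))"
proof -
  have "(\<Sum>v | length v = n. \<Sum>b\<in>UNIV. F (v @ [b])) = (\<Sum>(v, b)\<in>{v. length v = n} \<times> UNIV. F (v @ [b]))"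
    by (rule sum.cartesian_product)
  also have "\<dots> = (\<Sum>v | length v = Suc n. F v)"
    by (rule sum.reindex_bij_witness[of _ "\<lambda>v. (butlast v, last v)" "\<lambda>(v, b). v @ [b]"])
      (auto intro!: append_butlast_last_id)
  finally show ?thesis by simp
qed

lemma measure_pmf_mono: "(\<And>\<omega>. P \<omega> \<Longrightarrow> Q \<omega>) \<Longrightarrow> measure (measure_pmf q) {\<omega>. P \<omega>} \<le> measure (measure_pmf q) {\<omega>. Q \<omega>}"
  by (rule measure_pmf.finite_measure_mono) auto

lemma measure_pmf_cong_set:
  "(\<And>\<omega>. \<omega> \<in> set_pmf q \<Longrightarrow> P \<omega> \<longleftrightarrow> Q \<omega>) \<Longrightarrow> measure (measure_pmf q) {\<omega>. P \<omega>} = measure (measure_pmf q) {\<omega>. Q \<omega>}"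
  by (rule measure_eq_AE) (auto simp: AE_measure_pmf_iff)

text \<open>Telescoping over the length \<open>n\<close> of the prefix. \<open>Y\<close> is the
  whole past with all sources, \<open>h\<close> selects what the broadcaster knows, and
  \<open>markov\<close> says that \<open>V\<close> and \<open>Y\<close> are conditionally
  independent given \<open>h (Y \<omega>)\<close>. The weight \<open>\<mu>\<close> of the past is
  arbitrary, so that its own error is carried along and rounds can be chained.\<close>

lemma round_error:
  fixes q :: "'s pmf" and V :: "'s \<Rightarrow> bit list" and Y :: "'s \<Rightarrow> 'y" and h :: "'y \<Rightarrow> 'w"
    and \<kappa> :: "nat \<Rightarrow> bit list \<Rightarrow> 'w \<Rightarrow> bit \<Rightarrow> real"
  assumes fin: "finite (set_pmf q)" and len: "\<And>\<omega>. \<omega> \<in> set_pmf q \<Longrightarrow> length (V \<omega>) = N"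
    and markov: "\<And>S \<omega>0. \<omega>0 \<in> set_pmf q \<Longrightarrow>
      measure q {\<omega>. V \<omega> \<in> S \<and> Y \<omega> = Y \<omega>0} * measure q {\<omega>. h (Y \<omega>) = h (Y \<omega>0)} =
      measure q {\<omega>. V \<omega> \<in> S \<and> h (Y \<omega>) = h (Y \<omega>0)} * measure q {\<omega>. Y \<omega> = Y \<omega>0}"
    and \<kappa>_nonneg: "\<And>k v w b. \<kappa> k v w b \<ge> 0"
    and \<kappa>_le: "\<And>k v w. (\<Sum>b\<in>UNIV. \<kappa> k v w b) \<le> 1"
    and "finite SY" "n \<le> N"
  shows "(\<Sum>y\<in>SY. \<Sum>v | length v = n.
      \<bar>\<mu> y * (\<Prod>k<n. \<kappa> k (take k v) (h y) (v ! k)) - measure q {\<omega>. take n (V \<omega>) = v \<and> Y \<omega> = y}\<bar>)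
    \<le> (\<Sum>y\<in>SY. \<bar>\<mu> y - measure q {\<omega>. Y \<omega> = y}\<bar>) +
      (\<Sum>k<n. mean q (\<lambda>\<omega>. \<Sum>b\<in>UNIV. \<bar>\<kappa> k (take k (V \<omega>)) (h (Y \<omega>)) b -
         cprob q (\<lambda>\<omega>. V \<omega> ! k) (\<lambda>\<omega>. (take k (V \<omega>), h (Y \<omega>))) \<omega> b\<bar>))"
  using \<open>n \<le> N\<close>
proof (induction n)
  case 0
  have "{v :: bit list. length v = 0} = {[]}" by auto
  then show ?case by simp
next
  case (Suc n)
  define A where "A y v = \<mu> y * (\<Prod>k<n. \<kappa> k (take k v) (h y) (v ! k))" for y v
  define P where "P y v = measure q {\<omega>. take n (V \<omega>) = v \<and> Y \<omega> = y}" for y v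
  define c where "c v w b = measure q {\<omega>. V \<omega> ! n = b \<and> (take n (V \<omega>), h (Y \<omega>)) = (v, w)} /
    measure q {\<omega>. (take n (V \<omega>), h (Y \<omega>)) = (v, w)}" for v w b
  let ?g = "\<lambda>v w. \<Sum>b\<in>UNIV. \<bar>\<kappa> n v w b - c v w b\<bar>"
  have P_nonneg: "P y v \<ge> 0" for y v by (simp add: P_def)
  \<comment> \<open>The chain rule, with the conditional law of the next bit given
    \<open>h y\<close> in place of \<open>y\<close>. It comes from two instances of
    \<open>markov\<close>, one for the prefix \<open>v\<close> and one for \<open>v\<close> extended
    by \<open>b\<close>.\<close>
  have split: "measure q {\<omega>. take (Suc n) (V \<omega>) = v @ [b] \<and> Y \<omega> = y} = P y v * c v (h y) b" if v: "length v = n" for y v b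
  proof -
    have "measure q {\<omega>. take (Suc n) (V \<omega>) = v @ [b] \<and> Y \<omega> = y} =
        measure q {\<omega>. V \<omega> \<in> {v'. take n v' = v \<and> v' ! n = b} \<and> Y \<omega> = y}"
      using len Suc.prems by (intro measure_pmf_cong_set) (simp add: take_Suc_conv_app_nth)
    also have "\<dots> = P y v * c v (h y) b"
    proof (cases "y \<in> Y ` set_pmf q")
      case False
      then have "measure q {\<omega>. V \<omega> \<in> {v'. take n v' = v \<and> v' ! n = b} \<and> Y \<omega> = y} = 0" "P y v = 0"
        unfolding P_def by (auto simp: measure_pmf_zero_iff)
      then show ?thesis by simp
    next
      case True
      then obtain \<omega>0 where w0: "\<omega>0 \<in> set_pmf q" "y = Y \<omega>0" by auto
      define my where "my = measure q {\<omega>. Y \<omega> = y}"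
      define mw where "mw = measure q {\<omega>. h (Y \<omega>) = h y}"
      define p1 where "p1 = measure q {\<omega>. take n (V \<omega>) = v \<and> h (Y \<omega>) = h y}"
      define p2 where "p2 = measure q {\<omega>. (take n (V \<omega>) = v \<and> V \<omega> ! n = b) \<and> h (Y \<omega>) = h y}"
      define r2 where "r2 = measure q {\<omega>. (take n (V \<omega>) = v \<and> V \<omega> ! n = b) \<and> Y \<omega> = y}"
      have mw: "mw > 0"
        unfolding mw_def w0(2) by (rule measure_pmf_posI[OF w0(1)]) simp
      have 1: "P y v * mw = p1 * my"
        using markov[OF w0(1), of "{v'. take n v' = v}"] by (simp add: P_def mw_def my_def p1_def w0(2))
      have 2: "r2 * mw = p2 * my"
        using markov[OF w0(1), of "{v'. take n v' = v \<and> v' ! n = b}"] by (simp add: r2_def mw_def my_def p2_def w0(2))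
      have c: "c v (h y) b = p2 / p1"
        unfolding c_def p1_def p2_def by (auto intro!: arg_cong2[of _ _ _ _ "(/)"] measure_pmf_cong_set)
      have "r2 = P y v * c v (h y) b"
      \<comment> \<open>For \<open>p1 = 0\<close> the quotient is only a default value, but then
        \<open>P y v\<close> is 0 because \<open>mw > 0\<close>, and \<open>P y v\<close> dominates
        \<open>r2\<close>.\<close>
      proof (cases "p1 = 0")
        case True
        then have "P y v = 0" using 1 mw by simp
        moreover have "r2 \<le> P y v" unfolding r2_def P_def by (rule measure_pmf_mono) simp
        moreover have "r2 \<ge> 0" by (simp add: r2_def)
        ultimately show ?thesis by simp
      next
        case False
        have "P y v = p1 * my / mw" "r2 = p2 * my / mw" using 1 2 mw by (simp_all add: field_simps)
        then show ?thesis using False by (simp add: c)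
      qed
      then show ?thesis by (simp add: r2_def)
    qed
    finally show ?thesis .
  qed
  \<comment> \<open>\<open>P y v * \<kappa> n v (h y) b\<close> is inserted in the middle. The old
    error is then multiplied by the kernel, whose mass is at most 1, and the new error is weighted
    by the true law instead of the approximating one.\<close>
  have step: "\<bar>A y v * \<kappa> n v (h y) b - P y v * c v (h y) b\<bar> \<le>
      \<bar>A y v - P y v\<bar> * \<kappa> n v (h y) b + P y v * \<bar>\<kappa> n v (h y) b - c v (h y) b\<bar>" for y v b
  proof -
    have "A y v * \<kappa> n v (h y) b - P y v * c v (h y) b =
        (A y v - P y v) * \<kappa> n v (h y) b + P y v * (\<kappa> n v (h y) b - c v (h y) b)"
      by (simp add: algebra_simps)
    also have "\<bar>\<dots>\<bar> \<le> \<bar>(A y v - P y v) * \<kappa> n v (h y) b\<bar> + \<bar>P y v * (\<kappa> n v (h y) b - c v (h y) b)\<bar>"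
      by (rule abs_triangle_ineq)
    finally show ?thesis using \<kappa>_nonneg P_nonneg by (simp add: abs_mult)
  qed
  have "(\<Sum>y\<in>SY. \<Sum>v | length v = Suc n.
      \<bar>\<mu> y * (\<Prod>k<Suc n. \<kappa> k (take k v) (h y) (v ! k)) - measure q {\<omega>. take (Suc n) (V \<omega>) = v \<and> Y \<omega> = y}\<bar>) =
      (\<Sum>y\<in>SY. \<Sum>v | length v = n. \<Sum>b\<in>UNIV. \<bar>A y v * \<kappa> n v (h y) b - P y v * c v (h y) b\<bar>)"
    unfolding sum_bit_lists_Suc by (intro sum.cong refl) (simp add: split A_def nth_append mult.assoc)
  also have "\<dots> \<le> (\<Sum>y\<in>SY. \<Sum>v | length v = n. \<bar>A y v - P y v\<bar> + P y v * ?g v (h y))"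
  proof (intro sum_mono)
    fix y v
    have "(\<Sum>b\<in>UNIV. \<bar>A y v * \<kappa> n v (h y) b - P y v * c v (h y) b\<bar>) \<le>
        (\<Sum>b\<in>UNIV. \<bar>A y v - P y v\<bar> * \<kappa> n v (h y) b + P y v * \<bar>\<kappa> n v (h y) b - c v (h y) b\<bar>)"
      by (intro sum_mono step)
    also have "\<dots> = \<bar>A y v - P y v\<bar> * (\<Sum>b\<in>UNIV. \<kappa> n v (h y) b) + P y v * ?g v (h y)"
      by (simp add: sum.distrib sum_distrib_left)
    also have "\<dots> \<le> \<bar>A y v - P y v\<bar> * 1 + P y v * ?g v (h y)"
      by (intro add_right_mono mult_left_mono \<kappa>_le) simp
    finally show "(\<Sum>b\<in>UNIV. \<bar>A y v * \<kappa> n v (h y) b - P y v * c v (h y) b\<bar>) \<le> \<bar>A y v - P y v\<bar> + P y v * ?g v (h y)"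
      by simp
  qed
  also have "\<dots> = (\<Sum>y\<in>SY. \<Sum>v | length v = n. \<bar>A y v - P y v\<bar>) + (\<Sum>y\<in>SY. \<Sum>v | length v = n. P y v * ?g v (h y))"
    by (simp only: sum.distrib)
  \<comment> \<open>Only an inequality, since \<open>SY\<close> is an arbitrary finite set and may
    miss values of \<open>Y\<close>.\<close>
  also have "(\<Sum>y\<in>SY. \<Sum>v | length v = n. P y v * ?g v (h y)) \<le> mean q (\<lambda>\<omega>. ?g (take n (V \<omega>)) (h (Y \<omega>)))"
  proof -
    let ?L = "{v :: bit list. length v = n}"
    have "(\<Sum>y\<in>SY. \<Sum>v\<in>?L. P y v * ?g v (h y)) =
        (\<Sum>y\<in>SY. \<Sum>v\<in>?L. \<Sum>\<omega>\<in>set_pmf q. pmf q \<omega> * of_bool (take n (V \<omega>) = v \<and> Y \<omega> = y) * ?g v (h y))"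
      unfolding P_def measure_eq_mean[OF fin] mean_def by (simp only: sum_distrib_right)
    also have "\<dots> = (\<Sum>y\<in>SY. \<Sum>\<omega>\<in>set_pmf q. \<Sum>v\<in>?L. pmf q \<omega> * of_bool (take n (V \<omega>) = v \<and> Y \<omega> = y) * ?g v (h y))"
      by (intro sum.cong refl sum.swap)
    also have "\<dots> = (\<Sum>\<omega>\<in>set_pmf q. \<Sum>y\<in>SY. \<Sum>v\<in>?L. pmf q \<omega> * of_bool (take n (V \<omega>) = v \<and> Y \<omega> = y) * ?g v (h y))"
      by (rule sum.swap)
    also have "\<dots> \<le> (\<Sum>\<omega>\<in>set_pmf q. pmf q \<omega> * ?g (take n (V \<omega>)) (h (Y \<omega>)))"
    proof (rule sum_mono)
      fix \<omega>
      let ?G = "pmf q \<omega> * ?g (take n (V \<omega>)) (h (Y \<omega>))"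
      have G: "?G \<ge> 0" by (intro mult_nonneg_nonneg sum_nonneg) auto
      have "(\<Sum>y\<in>SY. \<Sum>v\<in>?L. pmf q \<omega> * of_bool (take n (V \<omega>) = v \<and> Y \<omega> = y) * ?g v (h y)) =
          (\<Sum>y\<in>SY. \<Sum>v\<in>?L. if v = take n (V \<omega>) then (if y = Y \<omega> then ?G else 0) else 0)"
        by (intro sum.cong refl) auto
      also have "\<dots> = (\<Sum>y\<in>SY. if take n (V \<omega>) \<in> ?L then (if y = Y \<omega> then ?G else 0) else 0)"
        by (intro sum.cong refl sum.delta finite_bit_lists)
      also have "\<dots> \<le> (\<Sum>y\<in>SY. if y = Y \<omega> then ?G else 0)"
        using G by (intro sum_mono) auto
      also have "\<dots> = (if Y \<omega> \<in> SY then ?G else 0)"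
        by (rule sum.delta) (rule \<open>finite SY\<close>)
      also have "\<dots> \<le> ?G" using G by simp
      finally show "(\<Sum>y\<in>SY. \<Sum>v\<in>?L. pmf q \<omega> * of_bool (take n (V \<omega>) = v \<and> Y \<omega> = y) * ?g v (h y)) \<le> ?G" .
    qed
    finally show ?thesis by (simp only: mean_def)
  qed
  also have "mean q (\<lambda>\<omega>. ?g (take n (V \<omega>)) (h (Y \<omega>))) = mean q (\<lambda>\<omega>. \<Sum>b\<in>UNIV. \<bar>\<kappa> n (take n (V \<omega>)) (h (Y \<omega>)) b -
         cprob q (\<lambda>\<omega>. V \<omega> ! n) (\<lambda>\<omega>. (take n (V \<omega>), h (Y \<omega>))) \<omega> b\<bar>)"
    by (simp only: cprob_def c_def)
  also have "(\<Sum>y\<in>SY. \<Sum>v | length v = n. \<bar>A y v - P y v\<bar>) \<le> (\<Sum>y\<in>SY. \<bar>\<mu> y - measure q {\<omega>. Y \<omega> = y}\<bar>) +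
      (\<Sum>k<n. mean q (\<lambda>\<omega>. \<Sum>b\<in>UNIV. \<bar>\<kappa> k (take k (V \<omega>)) (h (Y \<omega>)) b -
         cprob q (\<lambda>\<omega>. V \<omega> ! k) (\<lambda>\<omega>. (take k (V \<omega>), h (Y \<omega>))) \<omega> b\<bar>))"
    unfolding A_def P_def using Suc.prems by (intro Suc.IH) simp
  finally show ?case by (simp add: add.assoc)
qed

subsection \<open>Memoryless sources\<close>

text \<open>The chance that a receiver with the same prefix and the same past as the broadcaster
  obtains the broadcaster's bit \<open>b\<close>. Received and shared bits agree with certainty,
  hence the value 1 without mention of the broadcaster's vector.\<close>

definition agree_prob ::
  "'a symbol pmf \<Rightarrow> nat \<Rightarrow> real \<Rightarrow> 'a null_laws \<Rightarrow> nat \<Rightarrow> nat \<Rightarrow> nat \<Rightarrow> bit list \<Rightarrow> bit list list \<Rightarrow> bit \<Rightarrow> real"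
  where "agree_prob p m \<beta> D n i k v us b =
    (if k \<in> I_sent p m \<beta> n i \<union> F_rand p m \<beta> n i then 1
     else pmf (if k \<in> F_det p \<beta> n i then law_V p D n i k v else law_VU p D n i k (v, us)) b)"

text \<open>The probability that the broadcaster draws \<open>b\<close> and that \<open>e\<close>
  receivers, independent given \<open>b\<close>, obtain \<open>b\<close> as well. Disagreement is
  simply lost mass.\<close>

definition round_kernel ::
  "'a symbol pmf \<Rightarrow> nat \<Rightarrow> real \<Rightarrow> 'a null_laws \<Rightarrow> nat \<Rightarrow> nat \<Rightarrow> nat \<Rightarrow> nat \<Rightarrow> bit list \<Rightarrow>
   'a list \<times> bit list list \<Rightarrow> bit \<Rightarrow> real"
  where "round_kernel p m \<beta> D n e i k v w b =
    pmf (gen_kernel p m \<beta> D n i k v (fst w) (snd w)) b * agree_prob p m \<beta> D n i k v (snd w) b ^ e"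

definition past :: "nat \<Rightarrow> nat \<Rightarrow> 'a symbol list \<Rightarrow> bit list list \<times> 'a list list" where
  "past m i \<omega> = (map (\<lambda>l. U_vec l \<omega>) [0..<i], map (\<lambda>j. X_vec j \<omega>) [0..<m])"

definition seen :: "nat \<Rightarrow> nat \<Rightarrow> bit list list \<times> 'a list list \<Rightarrow> 'a list \<times> bit list list" where
  "seen m i y = (snd y ! (i mod m), fst y)"

lemma agree_prob_bounds: "0 \<le> agree_prob p m \<beta> D n i k v us b" "agree_prob p m \<beta> D n i k v us b \<le> 1"
  by (auto simp: agree_prob_def pmf_le_1)

lemma round_kernel_nonneg: "0 \<le> round_kernel p m \<beta> D n e i k v w b"
  by (auto simp: round_kernel_def agree_prob_bounds)

lemma sum_round_kernel_le: "(\<Sum>b\<in>UNIV. round_kernel p m \<beta> D n e i k v w b) \<le> 1"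
proof -
  let ?g = "gen_kernel p m \<beta> D n i k v (fst w) (snd w)"
  have "(\<Sum>b\<in>UNIV. round_kernel p m \<beta> D n e i k v w b) \<le> (\<Sum>b\<in>UNIV. pmf ?g b)"
    unfolding round_kernel_def
    by (intro sum_mono mult_left_le power_le_one agree_prob_bounds) auto
  also have "\<dots> = 1"
    by (rule sum_pmf_eq_1) (auto simp: UNIV_bit)
  finally show ?thesis .
qed

text \<open>On values attained with positive probability the arbitrary choice \<open>d\<close> is
  not consulted, so the result holds for every family of null laws.\<close>

lemma pmf_cond_law:
  assumes "\<omega> \<in> set_pmf q"
  shows "pmf (cond_law d q T B (B \<omega>)) b = cprob q T B \<omega> b"
proof -
  let ?S = "{\<omega>'. B \<omega>' = B \<omega>}"
  have ne: "set_pmf q \<inter> ?S \<noteq> {}" using assms by auto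
  have "pmf (cond_law d q T B (B \<omega>)) b = measure (cond_pmf q ?S) {\<omega>'. T \<omega>' = b}"
    using assms by (simp add: cond_law_def pmf_map vimage_def)
  also have "\<dots> = measure q (?S \<inter> {\<omega>'. T \<omega>' = b}) / measure q ?S"
    unfolding cond_pmf.rep_eq[OF ne]
    by (rule measure_uniform_measure) (simp_all add: emeasure_measure_pmf_not_zero[OF ne])
  also have "?S \<inter> {\<omega>'. T \<omega>' = b} = {\<omega>'. T \<omega>' = b \<and> B \<omega>' = B \<omega>}" by auto
  finally show ?thesis by (simp only: cprob_def)
qed

lemma one_minus_power_le:
  fixes a :: real
  assumes "0 \<le> a"
  shows "1 - a ^ e \<le> real e * (1 - a)"
  using Bernoulli_inequality[of "a - 1" e] assms by (simp add: algebra_simps)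

lemma measure_by_value:
  assumes "finite (set_pmf q)" "finite A" "\<And>\<omega>. \<omega> \<in> set_pmf q \<Longrightarrow> F \<omega> \<in> A"
  shows "measure q {\<omega>. P (F \<omega>) \<and> E \<omega>} = (\<Sum>u\<in>A. of_bool (P u) * measure q {\<omega>. F \<omega> = u \<and> E \<omega>})"
proof -
  have "(\<Sum>u\<in>A. of_bool (P u) * measure q {\<omega>. F \<omega> = u \<and> E \<omega>}) =
      (\<Sum>u\<in>A. \<Sum>\<omega>\<in>set_pmf q. of_bool (P u) * (pmf q \<omega> * of_bool (F \<omega> = u \<and> E \<omega>)))"
    unfolding measure_eq_mean[OF assms(1)] mean_def sum_distrib_left ..
  also have "\<dots> = (\<Sum>\<omega>\<in>set_pmf q. \<Sum>u\<in>A. of_bool (P u) * (pmf q \<omega> * of_bool (F \<omega> = u \<and> E \<omega>)))"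
    by (rule sum.swap)
  also have "\<dots> = (\<Sum>\<omega>\<in>set_pmf q. \<Sum>u\<in>A. if u = F \<omega> then pmf q \<omega> * of_bool (P (F \<omega>) \<and> E \<omega>) else 0)"
    by (intro sum.cong refl) auto
  also have "\<dots> = (\<Sum>\<omega>\<in>set_pmf q. pmf q \<omega> * of_bool (P (F \<omega>) \<and> E \<omega>))"
    using assms by (intro sum.cong refl) (simp add: sum.delta)
  also have "\<dots> = measure q {\<omega>. P (F \<omega>) \<and> E \<omega>}"
    unfolding measure_eq_mean[OF assms(1)] mean_def ..
  finally show ?thesis ..
qed

lemma map_eq_map_iff_nth:
  assumes "length xs = N" "length ys = N"
  shows "map f xs = map f ys \<longleftrightarrow> (\<forall>k<N. f (xs ! k) = f (ys ! k))"
  using assms by (auto simp: list_eq_iff_nth_eq)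

text \<open>\<open>symbol\<close> fixes the lengths of both components on the support. Lists can
  therefore be compared entry by entry, and indices stay in range.\<close>

locale polar_source =
  fixes p :: "'a symbol pmf" and m t :: nat and \<X> :: "nat \<Rightarrow> 'a set"
  assumes m_pos: "m \<ge> 1"
    and finite_alphabet: "\<And>j. j < m \<Longrightarrow> finite (\<X> j)"
    and finite_support: "finite (set_pmf p)"
    and symbol: "\<And>s. s \<in> set_pmf p \<Longrightarrow> length (fst s) = m \<and> length (snd s) = t \<and> (\<forall>j<m. fst s ! j \<in> \<X> j)"
    and markov: "\<And>i. i < t \<Longrightarrow> markov_chain (measure_pmf p) (\<lambda>s. snd s ! i)
      (\<lambda>s. (take i (snd s), fst s ! (i mod m)))
      (\<lambda>s. map (\<lambda>l. fst s ! l) (filter (\<lambda>l. l \<noteq> i mod m) [0..<m]))"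
begin

lemma mod_m_less: "i mod m < m"
  using m_pos by simp

lemma finite_ideal: "finite (set_pmf (ideal p n))"
  unfolding ideal_def by (rule finite_set_replicate_pmf[OF finite_support])

lemma ideal_length: "\<omega> \<in> set_pmf (ideal p n) \<Longrightarrow> length \<omega> = 2 ^ n"
  by (simp add: ideal_def set_replicate_pmf)

lemma ideal_symbol: "\<omega> \<in> set_pmf (ideal p n) \<Longrightarrow> k < 2 ^ n \<Longrightarrow> \<omega> ! k \<in> set_pmf p"
  by (simp add: ideal_def set_replicate_pmf in_lists_conv_set)

text \<open>Transposition of a matrix of bits: a list of \<open>i\<close> vectors carries the same
  information as a vector of lists of length \<open>i\<close>. The bound \<open>i \<le> t\<close>
  ensures that \<open>take i\<close> really yields length \<open>i\<close>.\<close>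

lemma past_U_eq_iff:
  assumes "\<omega> \<in> set_pmf (ideal p n)" "\<omega>' \<in> set_pmf (ideal p n)" "i \<le> t"
  shows "map (\<lambda>l. U_vec l \<omega>) [0..<i] = map (\<lambda>l. U_vec l \<omega>') [0..<i] \<longleftrightarrow>
    map (\<lambda>s. take i (snd s)) \<omega> = map (\<lambda>s. take i (snd s)) \<omega>'"
proof -
  note len = ideal_length[OF assms(1)] ideal_length[OF assms(2)]
  have "map (\<lambda>l. U_vec l \<omega>) [0..<i] = map (\<lambda>l. U_vec l \<omega>') [0..<i] \<longleftrightarrow>
      (\<forall>l<i. \<forall>k<2 ^ n. snd (\<omega> ! k) ! l = snd (\<omega>' ! k) ! l)"
    unfolding U_vec_def map_eq_conv map_eq_map_iff_nth[OF len] by auto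
  also have "\<dots> \<longleftrightarrow> (\<forall>k<2 ^ n. take i (snd (\<omega> ! k)) = take i (snd (\<omega>' ! k)))"
  proof -
    have "take i (snd (\<omega> ! k)) = take i (snd (\<omega>' ! k)) \<longleftrightarrow> (\<forall>l<i. snd (\<omega> ! k) ! l = snd (\<omega>' ! k) ! l)"
      if "k < 2 ^ n" for k
      using symbol[OF ideal_symbol[OF assms(1) that]] symbol[OF ideal_symbol[OF assms(2) that]] assms(3)
      by (simp add: list_eq_iff_nth_eq)
    then show ?thesis by blast
  qed
  also have "\<dots> \<longleftrightarrow> map (\<lambda>s. take i (snd s)) \<omega> = map (\<lambda>s. take i (snd s)) \<omega>'"
    unfolding map_eq_map_iff_nth[OF len] ..
  finally show ?thesis .
qed

lemma past_eq_iff: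
  assumes "\<omega> \<in> set_pmf (ideal p n)" "\<omega>' \<in> set_pmf (ideal p n)" "i \<le> t"
  shows "past m i \<omega> = past m i \<omega>' \<longleftrightarrow>
    map (\<lambda>s. (take i (snd s), fst s)) \<omega> = map (\<lambda>s. (take i (snd s), fst s)) \<omega>'"
proof -
  note len = ideal_length[OF assms(1)] ideal_length[OF assms(2)]
  have "map (\<lambda>j. X_vec j \<omega>) [0..<m] = map (\<lambda>j. X_vec j \<omega>') [0..<m] \<longleftrightarrow>
      (\<forall>j<m. \<forall>k<2 ^ n. fst (\<omega> ! k) ! j = fst (\<omega>' ! k) ! j)"
    unfolding X_vec_def map_eq_conv map_eq_map_iff_nth[OF len] by auto
  also have "\<dots> \<longleftrightarrow> (\<forall>k<2 ^ n. fst (\<omega> ! k) = fst (\<omega>' ! k))"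
  proof -
    have "fst (\<omega> ! k) = fst (\<omega>' ! k) \<longleftrightarrow> (\<forall>j<m. fst (\<omega> ! k) ! j = fst (\<omega>' ! k) ! j)"
      if "k < 2 ^ n" for k
      using symbol[OF ideal_symbol[OF assms(1) that]] symbol[OF ideal_symbol[OF assms(2) that]]
      by (simp add: list_eq_iff_nth_eq)
    then show ?thesis by blast
  qed
  finally show ?thesis
    unfolding past_def prod.inject past_U_eq_iff[OF assms] map_eq_map_iff_nth[OF len] by auto
qed

lemma seen_past_eq_iff:
  assumes "\<omega> \<in> set_pmf (ideal p n)" "\<omega>' \<in> set_pmf (ideal p n)" "i \<le> t"
  shows "seen m i (past m i \<omega>) = seen m i (past m i \<omega>') \<longleftrightarrow>
    map (\<lambda>s. (take i (snd s), fst s ! (i mod m))) \<omega> = map (\<lambda>s. (take i (snd s), fst s ! (i mod m))) \<omega>'"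
  unfolding past_def seen_def fst_conv snd_conv prod.inject past_U_eq_iff[OF assms]
  using mod_m_less[of i] ideal_length[OF assms(1)] ideal_length[OF assms(2)]
  by (auto simp: X_vec_def map_eq_map_iff_nth[where N = "2 ^ n"])

text \<open>The full tuple of sources is the broadcaster's component together with the others, so
  \<open>y\<close> splits into \<open>w\<close> and the last variable of the Markov chain.\<close>

lemma markov_symbol:
  assumes "i < t" "s0 \<in> set_pmf p"
  defines "y \<equiv> \<lambda>s :: 'a symbol. (take i (snd s), fst s)"
    and "w \<equiv> \<lambda>s :: 'a symbol. (take i (snd s), fst s ! (i mod m))"
  shows "measure p {s. (snd s ! i, y s) = (a, y s0)} * measure p {s. w s = w s0} =
    measure p {s. (snd s ! i, w s) = (a, w s0)} * measure p {s. y s = y s0}"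
proof -
  let ?c = "\<lambda>s :: 'a symbol. map (\<lambda>l. fst s ! l) (filter (\<lambda>l. l \<noteq> i mod m) [0..<m])"
  have y_iff: "y s = y s0 \<longleftrightarrow> w s = w s0 \<and> ?c s = ?c s0" if "s \<in> set_pmf p" for s
  proof -
    have "fst s = fst s0 \<longleftrightarrow> (\<forall>j<m. fst s ! j = fst s0 ! j)"
      using symbol[OF that] symbol[OF assms(2)] by (simp add: list_eq_iff_nth_eq)
    then show ?thesis using mod_m_less[of i] by (auto simp: y_def w_def)
  qed
  have "measure p {s. snd s ! i = a \<and> w s = w s0 \<and> ?c s = ?c s0} * measure p {s. w s = w s0} =
      measure p {s. snd s ! i = a \<and> w s = w s0} * measure p {s. w s = w s0 \<and> ?c s = ?c s0}"
    using markov[OF assms(1), unfolded markov_chain_def, rule_format, of a "w s0" "?c s0"]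
    unfolding w_def space_measure_pmf by simp
  moreover have "measure p {s. (snd s ! i, y s) = (a, y s0)} = measure p {s. snd s ! i = a \<and> w s = w s0 \<and> ?c s = ?c s0}"
    by (rule measure_pmf_cong_set) (simp add: y_iff)
  moreover have "measure p {s. y s = y s0} = measure p {s. w s = w s0 \<and> ?c s = ?c s0}"
    by (rule measure_pmf_cong_set) (simp add: y_iff)
  ultimately show ?thesis by simp
qed

text \<open>All four events become conditions on single symbols once the vectors are transposed.
  Their probabilities are then products over the positions, and the one-symbol identities are
  multiplied.\<close>

lemma markov_U_vec:
  assumes "i < t" "\<omega>0 \<in> set_pmf (ideal p n)" "length u = 2 ^ n"
  shows "measure (ideal p n) {\<omega>. U_vec i \<omega> = u \<and> past m i \<omega> = past m i \<omega>0} *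
      measure (ideal p n) {\<omega>. seen m i (past m i \<omega>) = seen m i (past m i \<omega>0)} =
    measure (ideal p n) {\<omega>. U_vec i \<omega> = u \<and> seen m i (past m i \<omega>) = seen m i (past m i \<omega>0)} *
      measure (ideal p n) {\<omega>. past m i \<omega> = past m i \<omega>0}"
proof -
  let ?y = "\<lambda>s :: 'a symbol. (take i (snd s), fst s)"
    and ?w = "\<lambda>s :: 'a symbol. (take i (snd s), fst s ! (i mod m))"
  have it: "i \<le> t" using assms(1) by simp
  note len = ideal_length[OF assms(2)]
  have single: "measure (ideal p n) {\<omega>. map g \<omega> = map g \<omega>0} = (\<Prod>k<2 ^ n. measure p {s. g s = g (\<omega>0 ! k)})" for g :: "'a symbol \<Rightarrow> 'z"
    unfolding ideal_def using len by (subst measure_map_replicate_pmf) auto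
  have joint: "measure (ideal p n) {\<omega>. U_vec i \<omega> = u \<and> map g \<omega> = map g \<omega>0} =
      (\<Prod>k<2 ^ n. measure p {s. (snd s ! i, g s) = (u ! k, g (\<omega>0 ! k))})" for g :: "'a symbol \<Rightarrow> 'z"
  proof -
    have "measure (ideal p n) {\<omega>. U_vec i \<omega> = u \<and> map g \<omega> = map g \<omega>0} =
        measure (ideal p n) {\<omega>. map (\<lambda>s. (snd s ! i, g s)) \<omega> = zip u (map g \<omega>0)}"
      using assms(3) len
      by (intro measure_pmf_cong_set) (auto simp: U_vec_def list_eq_iff_nth_eq ideal_length)
    also have "\<dots> = (\<Prod>k<2 ^ n. measure p {s. (snd s ! i, g s) = zip u (map g \<omega>0) ! k})"
      unfolding ideal_def using len assms(3) by (intro measure_map_replicate_pmf) simp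
    finally show ?thesis using len assms(3) by simp
  qed
  have "measure (ideal p n) {\<omega>. U_vec i \<omega> = u \<and> past m i \<omega> = past m i \<omega>0} =
      measure (ideal p n) {\<omega>. U_vec i \<omega> = u \<and> map ?y \<omega> = map ?y \<omega>0}"
    by (rule measure_pmf_cong_set) (simp add: past_eq_iff[OF _ assms(2) it])
  moreover have "measure (ideal p n) {\<omega>. past m i \<omega> = past m i \<omega>0} =
      measure (ideal p n) {\<omega>. map ?y \<omega> = map ?y \<omega>0}"
    by (rule measure_pmf_cong_set) (simp add: past_eq_iff[OF _ assms(2) it])
  moreover have "measure (ideal p n) {\<omega>. U_vec i \<omega> = u \<and> seen m i (past m i \<omega>) = seen m i (past m i \<omega>0)} =
      measure (ideal p n) {\<omega>. U_vec i \<omega> = u \<and> map ?w \<omega> = map ?w \<omega>0}"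
    by (rule measure_pmf_cong_set) (simp add: seen_past_eq_iff[OF _ assms(2) it])
  moreover have "measure (ideal p n) {\<omega>. seen m i (past m i \<omega>) = seen m i (past m i \<omega>0)} =
      measure (ideal p n) {\<omega>. map ?w \<omega> = map ?w \<omega>0}"
    by (rule measure_pmf_cong_set) (simp add: seen_past_eq_iff[OF _ assms(2) it])
  moreover have "(\<Prod>k<2 ^ n. measure p {s. (snd s ! i, ?y s) = (u ! k, ?y (\<omega>0 ! k))}) * (\<Prod>k<2 ^ n. measure p {s. ?w s = ?w (\<omega>0 ! k)}) =
      (\<Prod>k<2 ^ n. measure p {s. (snd s ! i, ?w s) = (u ! k, ?w (\<omega>0 ! k))}) * (\<Prod>k<2 ^ n. measure p {s. ?y s = ?y (\<omega>0 ! k)})"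
    unfolding prod.distrib[symmetric]
    by (intro prod.cong refl markov_symbol[OF assms(1)] ideal_symbol[OF assms(2)]) simp
  ultimately show ?thesis by (simp only: joint single)
qed

text \<open>\<open>V_vec\<close> is a function of \<open>U_vec\<close>, and the identity is linear
  in the law of \<open>U_vec\<close>: it is summed over all \<open>u\<close> with
  \<open>polar n u \<in> S\<close>.\<close>

lemma markov_V_vec:
  assumes "i < t" "\<omega>0 \<in> set_pmf (ideal p n)"
  shows "measure (ideal p n) {\<omega>. V_vec n i \<omega> \<in> S \<and> past m i \<omega> = past m i \<omega>0} *
      measure (ideal p n) {\<omega>. seen m i (past m i \<omega>) = seen m i (past m i \<omega>0)} =
    measure (ideal p n) {\<omega>. V_vec n i \<omega> \<in> S \<and> seen m i (past m i \<omega>) = seen m i (past m i \<omega>0)} *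
      measure (ideal p n) {\<omega>. past m i \<omega> = past m i \<omega>0}"
proof -
  have split: "measure (ideal p n) {\<omega>. V_vec n i \<omega> \<in> S \<and> E \<omega>} =
      (\<Sum>u | length u = 2 ^ n. of_bool (polar n u \<in> S) * measure (ideal p n) {\<omega>. U_vec i \<omega> = u \<and> E \<omega>})" for E
    unfolding V_vec_def
    by (rule measure_by_value[OF finite_ideal finite_bit_lists, where P = "\<lambda>u. polar n u \<in> S"])
      (simp add: U_vec_def ideal_length)
  show ?thesis
    unfolding split sum_distrib_right
    by (intro sum.cong refl) (simp add: mult.assoc markov_U_vec[OF assms])
qed

end

section \<open>Kernel errors under the ideal law\<close>

lemma delta_pos: "0 < delta \<beta> n" and delta_le_1: "delta \<beta> n \<le> 1"
  by (auto simp: delta_def powr_le_one_le powr_minus_divide ge_one_powr_ge_zero)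

lemma delta_le_sqrt: "delta \<beta> n \<le> sqrt (delta \<beta> n)"
proof -
  have "sqrt (delta \<beta> n) * sqrt (delta \<beta> n) \<le> sqrt (delta \<beta> n) * 1"
    using delta_le_1[of \<beta> n] delta_pos[of \<beta> n] by (intro mult_left_mono) auto
  then show ?thesis using delta_pos[of \<beta> n] by simp
qed

text \<open>The loss \<open>1 - a ^ e\<close> is charged to the true probability \<open>c\<close>
  and not to \<open>g\<close>. The second term is thus an average under the ideal law, where the
  Bhattacharyya parameters control it; the factor \<open>e\<close> is Bernoulli's
  inequality.\<close>

lemma agreement_discount:
  fixes g a c :: real
  assumes "0 \<le> a" "a \<le> 1" "0 \<le> c"
  shows "\<bar>g * a ^ e - c\<bar> \<le> \<bar>g - c\<bar> + real e * (c * (1 - a))"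
proof -
  have p: "0 \<le> a ^ e" "a ^ e \<le> 1" using assms by (auto intro: power_le_one)
  have "g * a ^ e - c = (g - c) * a ^ e - c * (1 - a ^ e)"
    by (simp add: algebra_simps)
  then have "\<bar>g * a ^ e - c\<bar> \<le> \<bar>(g - c) * a ^ e\<bar> + \<bar>c * (1 - a ^ e)\<bar>"
    by (simp only: abs_triangle_ineq4)
  also have "\<dots> = \<bar>g - c\<bar> * a ^ e + c * (1 - a ^ e)"
    using p assms by (simp add: abs_mult)
  also have "\<dots> \<le> \<bar>g - c\<bar> * 1 + c * (real e * (1 - a))"
    using p assms by (intro add_mono mult_left_mono one_minus_power_le) auto
  finally show ?thesis by (simp add: mult.left_commute)
qed

context polar_source
begin

definition weight :: "real \<Rightarrow> 'a null_laws \<Rightarrow> nat \<Rightarrow> nat \<Rightarrow> nat \<Rightarrow> bit list list \<Rightarrow> 'a list list \<Rightarrow> real" where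
  "weight \<beta> D n e i us xs =
    (\<Prod>k<2 ^ n. pmf (map_pmf fst p) (map (\<lambda>x. x ! k) xs)) *
    (\<Prod>l<i. \<Prod>k<2 ^ n. round_kernel p m \<beta> D n e l k
       (take k (polar n (us ! l))) (xs ! (l mod m), take l us) (polar n (us ! l) ! k))"

lemma V_vec_eq: "V_vec n i \<omega> = polar n (map (\<lambda>s. snd s ! i) \<omega>)"
  by (simp add: V_vec_def U_vec_def)

lemma gen_kernel_error:
  assumes i: "i < t" and k: "k < 2 ^ n"
  shows "mean (ideal p n) (\<lambda>\<omega>. \<Sum>b\<in>UNIV.
      \<bar>pmf (gen_kernel p m \<beta> D n i k (take k (V_vec n i \<omega>)) (X_vec (i mod m) \<omega>) (map (\<lambda>l. U_vec l \<omega>) [0..<i])) b -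
       cprob (ideal p n) (\<lambda>\<omega>. V_vec n i \<omega> ! k)
         (\<lambda>\<omega>. (take k (V_vec n i \<omega>), X_vec (i mod m) \<omega>, map (\<lambda>l. U_vec l \<omega>) [0..<i])) \<omega> b\<bar>)
    \<le> 2 * sqrt (delta \<beta> n)" (is "mean ?q (\<lambda>\<omega>. \<Sum>b\<in>UNIV. \<bar>pmf (?g \<omega>) b - cprob ?q ?T ?B \<omega> b\<bar>) \<le> _")
proof -
  have it: "i \<le> t" using i by simp
  let ?A = "\<lambda>\<omega>. take k (V_vec n i \<omega>)"
  consider "k \<in> F_rand p m \<beta> n i" | "k \<notin> F_rand p m \<beta> n i" "k \<in> F_det p \<beta> n i"
    | "k \<notin> F_rand p m \<beta> n i" "k \<notin> F_det p \<beta> n i" by blast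
  then show ?thesis
  proof cases
    case 1
    \<comment> \<open>\<open>?C\<close> is the conditioning as encoded in \<open>high_U\<close>,
      \<open>?B\<close> the same information as the kernel receives it.\<close>
    let ?C = "\<lambda>\<omega>. (take k (polar n (map (\<lambda>s. snd s ! i) \<omega>)), map (\<lambda>s. (fst s ! (i mod m), take i (snd s))) \<omega>)"
    have "1 - delta \<beta> n \<le> bhattacharyya ?q ?T ?C"
      using 1 by (simp add: F_rand_def high_U_def high_set_cond_def ideal_def V_vec_def U_vec_def)
    also have "\<dots> = bhattacharyya ?q ?T ?B"
    proof (rule bhattacharyya_cong[OF finite_ideal])
      fix \<omega> \<omega>' assume w: "\<omega> \<in> set_pmf ?q" "\<omega>' \<in> set_pmf ?q"
      note len = ideal_length[OF w(1)] ideal_length[OF w(2)]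
      show "?C \<omega>' = ?C \<omega> \<longleftrightarrow> ?B \<omega>' = ?B \<omega>"
        unfolding prod.inject past_U_eq_iff[OF w(2,1) it] X_vec_def map_eq_map_iff_nth[OF len(2,1)] V_vec_eq
        by auto
    qed
    finally have Z: "1 - delta \<beta> n \<le> bhattacharyya ?q ?T ?B" .
    have "?g \<omega> = pmf_of_set {0, 1}" for \<omega> using 1 by (simp add: gen_kernel_def)
    then have "pmf (?g \<omega>) b = 1 / 2" for \<omega> b
      using bit_eq_0_or_1[of b] by (simp add: pmf_of_set indicator_def)
    then have "mean ?q (\<lambda>\<omega>. \<Sum>b\<in>UNIV. \<bar>pmf (?g \<omega>) b - cprob ?q ?T ?B \<omega> b\<bar>) \<le> sqrt (2 * delta \<beta> n)"
      using uniform_bit_error[OF finite_ideal Z delta_pos] by (simp only:)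
    also have "\<dots> \<le> sqrt (2\<^sup>2 * delta \<beta> n)" using delta_pos[of \<beta> n] by simp
    also have "\<dots> = 2 * sqrt (delta \<beta> n)" by (simp add: real_sqrt_mult)
    finally show ?thesis .
  next
    case 2
    have g: "pmf (?g \<omega>) b = cprob ?q ?T ?A \<omega> b" if "\<omega> \<in> set_pmf ?q" for \<omega> b
      using 2 pmf_cond_law[OF that, of _ ?T ?A] by (simp add: gen_kernel_def law_V_def)
    have "mean ?q (\<lambda>\<omega>. \<Sum>b\<in>UNIV. \<bar>pmf (?g \<omega>) b - cprob ?q ?T ?B \<omega> b\<bar>) =
        mean ?q (\<lambda>\<omega>. \<Sum>b\<in>UNIV. \<bar>cprob ?q ?T ?A \<omega> b - cprob ?q ?T ?B \<omega> b\<bar>)"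
      by (intro mean_cong sum.cong refl) (simp only: g)
    also have "\<dots> \<le> bhattacharyya ?q ?T ?A"
      by (rule coarse_bit_error[OF finite_ideal]) simp
    also have "\<dots> \<le> delta \<beta> n"
      using 2 by (simp add: F_det_def low_U_def low_set_def ideal_def V_vec_def U_vec_def)
    also have "\<dots> \<le> 2 * sqrt (delta \<beta> n)" using delta_le_sqrt[of \<beta> n] delta_pos[of \<beta> n] by simp
    finally show ?thesis .
  next
    case 3
    have g: "pmf (?g \<omega>) b = cprob ?q ?T ?B \<omega> b" if "\<omega> \<in> set_pmf ?q" for \<omega> b
      using 3 pmf_cond_law[OF that, of _ ?T ?B] by (simp add: gen_kernel_def law_VXU_def)
    have "mean ?q (\<lambda>\<omega>. \<Sum>b\<in>UNIV. \<bar>pmf (?g \<omega>) b - cprob ?q ?T ?B \<omega> b\<bar>) = mean ?q (\<lambda>\<omega>. 0)"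
      by (intro mean_cong) (simp add: g)
    also have "\<dots> = 0" by (simp add: mean_const finite_ideal)
    finally show ?thesis using delta_pos[of \<beta> n] by simp
  qed
qed

text \<open>A sampling receiver conditions on less than the broadcaster knows, while the bit to be
  matched follows the finer law. This is the situation of \<open>cross_bit_error\<close>, with
  \<open>A\<close> the receiver's knowledge.\<close>

lemma agree_prob_error:
  assumes i: "i < t" and k: "k < 2 ^ n"
  shows "mean (ideal p n) (\<lambda>\<omega>. \<Sum>b\<in>UNIV.
      cprob (ideal p n) (\<lambda>\<omega>. V_vec n i \<omega> ! k)
        (\<lambda>\<omega>. (take k (V_vec n i \<omega>), X_vec (i mod m) \<omega>, map (\<lambda>l. U_vec l \<omega>) [0..<i])) \<omega> b *
      (1 - agree_prob p m \<beta> D n i k (take k (V_vec n i \<omega>)) (map (\<lambda>l. U_vec l \<omega>) [0..<i]) b))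
    \<le> sqrt (delta \<beta> n)" (is "mean ?q (\<lambda>\<omega>. \<Sum>b\<in>UNIV. cprob ?q ?T ?B \<omega> b * (1 - ?a \<omega> b)) \<le> _")
proof -
  have it: "i \<le> t" using i by simp
  have by_Z: "mean ?q (\<lambda>\<omega>. \<Sum>b\<in>UNIV. cprob ?q ?T ?B \<omega> b * (1 - ?a \<omega> b)) \<le> sqrt (delta \<beta> n)"
    if a: "\<And>\<omega> b. \<omega> \<in> set_pmf ?q \<Longrightarrow> ?a \<omega> b = cprob ?q ?T A \<omega> b"
      and A: "\<And>\<omega> \<omega>'. ?B \<omega> = ?B \<omega>' \<Longrightarrow> A \<omega> = A \<omega>'" and Z: "bhattacharyya ?q ?T A \<le> delta \<beta> n"
    for A :: "'a symbol list \<Rightarrow> 'z"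
  proof -
    have "mean ?q (\<lambda>\<omega>. \<Sum>b\<in>UNIV. cprob ?q ?T ?B \<omega> b * (1 - ?a \<omega> b)) =
        mean ?q (\<lambda>\<omega>. \<Sum>b\<in>UNIV. cprob ?q ?T ?B \<omega> b * (1 - cprob ?q ?T A \<omega> b))"
      by (intro mean_cong sum.cong refl) (simp only: a)
    also have "\<dots> \<le> bhattacharyya ?q ?T A / 2"
      by (rule cross_bit_error[OF finite_ideal]) (rule A)
    finally show ?thesis using Z delta_le_sqrt[of \<beta> n] delta_pos[of \<beta> n] by linarith
  qed
  consider "k \<in> I_sent p m \<beta> n i \<union> F_rand p m \<beta> n i"
    | "k \<notin> I_sent p m \<beta> n i \<union> F_rand p m \<beta> n i" "k \<in> F_det p \<beta> n i"
    | "k \<notin> I_sent p m \<beta> n i \<union> F_rand p m \<beta> n i" "k \<notin> F_det p \<beta> n i" by blast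
  then show ?thesis
  proof cases
    case 1
    then have "?a \<omega> b = 1" for \<omega> b by (simp only: agree_prob_def if_True)
    then have "mean ?q (\<lambda>\<omega>. \<Sum>b\<in>UNIV. cprob ?q ?T ?B \<omega> b * (1 - ?a \<omega> b)) = mean ?q (\<lambda>\<omega>. 0)"
      by (intro mean_cong) simp
    also have "\<dots> = 0" by (simp add: mean_const finite_ideal)
    finally show ?thesis using delta_pos[of \<beta> n] by simp
  next
    case 2
    let ?A = "\<lambda>\<omega>. take k (V_vec n i \<omega>)"
    show ?thesis
    proof (rule by_Z)
      show "bhattacharyya ?q ?T ?A \<le> delta \<beta> n"
        using 2(2) by (simp add: F_det_def low_U_def low_set_def ideal_def V_vec_def U_vec_def)
      show "?a \<omega> b = cprob ?q ?T ?A \<omega> b" if "\<omega> \<in> set_pmf ?q" for \<omega> b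
        using 2 pmf_cond_law[OF that, of _ ?T ?A] by (simp add: agree_prob_def law_V_def)
    qed simp
  next
    case 3
    let ?A = "\<lambda>\<omega>. (take k (V_vec n i \<omega>), map (\<lambda>l. U_vec l \<omega>) [0..<i])"
    let ?C = "\<lambda>\<omega>. (take k (polar n (map (\<lambda>s. snd s ! i) \<omega>)), map (\<lambda>s. take i (snd s)) \<omega>)"
    show ?thesis
    proof (rule by_Z)
      \<comment> \<open>Outside \<open>F_det\<close> and \<open>F_rand\<close> the position lies in
        \<open>I_info\<close>; as it is not sent, it was removed by the set
        \<open>low_U_past\<close>.\<close>
      have "k \<in> low_U_past p \<beta> n i"
        using 3 k by (auto simp: I_sent_def I_info_def F_rand_def F_det_def)
      then have "bhattacharyya ?q ?T ?C \<le> delta \<beta> n"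
        by (simp add: low_U_past_def low_set_cond_def ideal_def V_vec_def U_vec_def)
      moreover have "bhattacharyya ?q ?T ?A = bhattacharyya ?q ?T ?C"
      proof (rule bhattacharyya_cong[OF finite_ideal])
        fix \<omega> \<omega>' assume w: "\<omega> \<in> set_pmf ?q" "\<omega>' \<in> set_pmf ?q"
        show "?A \<omega>' = ?A \<omega> \<longleftrightarrow> ?C \<omega>' = ?C \<omega>"
          unfolding prod.inject past_U_eq_iff[OF w(2,1) it] V_vec_eq ..
      qed
      ultimately show "bhattacharyya ?q ?T ?A \<le> delta \<beta> n" by simp
      show "?a \<omega> b = cprob ?q ?T ?A \<omega> b" if "\<omega> \<in> set_pmf ?q" for \<omega> b
        using 3 pmf_cond_law[OF that, of _ ?T ?A] by (simp add: agree_prob_def law_VU_def)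
    qed simp
  qed
qed

lemma round_kernel_error:
  assumes i: "i < t" and k: "k < 2 ^ n"
  shows "mean (ideal p n) (\<lambda>\<omega>. \<Sum>b\<in>UNIV.
      \<bar>round_kernel p m \<beta> D n e i k (take k (V_vec n i \<omega>)) (seen m i (past m i \<omega>)) b -
       cprob (ideal p n) (\<lambda>\<omega>. V_vec n i \<omega> ! k) (\<lambda>\<omega>. (take k (V_vec n i \<omega>), seen m i (past m i \<omega>))) \<omega> b\<bar>)
    \<le> (2 + real e) * sqrt (delta \<beta> n)"
proof -
  let ?q = "ideal p n" and ?T = "\<lambda>\<omega>. V_vec n i \<omega> ! k"
  let ?B = "\<lambda>\<omega>. (take k (V_vec n i \<omega>), X_vec (i mod m) \<omega>, map (\<lambda>l. U_vec l \<omega>) [0..<i])"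
  let ?g = "\<lambda>\<omega>. pmf (gen_kernel p m \<beta> D n i k (take k (V_vec n i \<omega>)) (X_vec (i mod m) \<omega>) (map (\<lambda>l. U_vec l \<omega>) [0..<i]))"
  let ?a = "\<lambda>\<omega>. agree_prob p m \<beta> D n i k (take k (V_vec n i \<omega>)) (map (\<lambda>l. U_vec l \<omega>) [0..<i])"
  let ?c = "cprob ?q ?T ?B"
  have seen: "seen m i (past m i \<omega>) = (X_vec (i mod m) \<omega>, map (\<lambda>l. U_vec l \<omega>) [0..<i])" for \<omega> :: "'a symbol list"
    using mod_m_less[of i] by (simp add: seen_def past_def)
  have "mean ?q (\<lambda>\<omega>. \<Sum>b\<in>UNIV. \<bar>?g \<omega> b * ?a \<omega> b ^ e - ?c \<omega> b\<bar>) \<le>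
      mean ?q (\<lambda>\<omega>. (\<Sum>b\<in>UNIV. \<bar>?g \<omega> b - ?c \<omega> b\<bar>) + real e * (\<Sum>b\<in>UNIV. ?c \<omega> b * (1 - ?a \<omega> b)))"
  proof (rule mean_mono)
    fix \<omega>
    have "\<bar>?g \<omega> b * ?a \<omega> b ^ e - ?c \<omega> b\<bar> \<le> \<bar>?g \<omega> b - ?c \<omega> b\<bar> + real e * (?c \<omega> b * (1 - ?a \<omega> b))" for b
      by (rule agreement_discount) (simp_all only: agree_prob_bounds cprob_nonneg)
    then have "(\<Sum>b\<in>UNIV. \<bar>?g \<omega> b * ?a \<omega> b ^ e - ?c \<omega> b\<bar>) \<le>
        (\<Sum>b\<in>UNIV. \<bar>?g \<omega> b - ?c \<omega> b\<bar> + real e * (?c \<omega> b * (1 - ?a \<omega> b)))"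
      by (intro sum_mono)
    then show "(\<Sum>b\<in>UNIV. \<bar>?g \<omega> b * ?a \<omega> b ^ e - ?c \<omega> b\<bar>) \<le>
        (\<Sum>b\<in>UNIV. \<bar>?g \<omega> b - ?c \<omega> b\<bar>) + real e * (\<Sum>b\<in>UNIV. ?c \<omega> b * (1 - ?a \<omega> b))"
      by (simp only: sum.distrib sum_distrib_left)
  qed
  also have "\<dots> = mean ?q (\<lambda>\<omega>. \<Sum>b\<in>UNIV. \<bar>?g \<omega> b - ?c \<omega> b\<bar>) + real e * mean ?q (\<lambda>\<omega>. \<Sum>b\<in>UNIV. ?c \<omega> b * (1 - ?a \<omega> b))"
    unfolding mean_add mean_cmult ..
  also have "\<dots> \<le> 2 * sqrt (delta \<beta> n) + real e * sqrt (delta \<beta> n)"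
    by (intro add_mono mult_left_mono gen_kernel_error agree_prob_error assms) simp
  finally show ?thesis
    unfolding seen round_kernel_def fst_conv snd_conv distrib_right .
qed

section \<open>Accumulation of errors over the rounds\<close>

lemma finite_bit_vecs: "finite (bit_vecs i N)"
  using finite_lists_length_eq[OF finite_bit_lists[of N], of i]
  by (rule rev_finite_subset) (auto simp: bit_vecs_def)

lemma finite_source_vecs: "finite (source_vecs \<X> m N)"
proof -
  have "finite (\<Union>j<m. \<X> j)" using finite_alphabet by simp
  from finite_lists_length_eq[OF finite_lists_length_eq[OF this, of N], of m] show ?thesis
    by (rule rev_finite_subset) (fastforce simp: source_vecs_def in_set_conv_nth)
qed

text \<open>The last vector of the transcript is replaced by its transform, a bijective change of
  variables since the transform is an involution. The new variable is the one generated bit by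
  bit.\<close>

lemma sum_bit_vecs_Suc:
  fixes F :: "bit list list \<Rightarrow> 'a list list \<Rightarrow> real"
  shows "(\<Sum>(us, xs)\<in>bit_vecs (Suc i) (2 ^ n) \<times> source_vecs \<X> m (2 ^ n). F us xs) =
    (\<Sum>y\<in>bit_vecs i (2 ^ n) \<times> source_vecs \<X> m (2 ^ n). \<Sum>v | length v = 2 ^ n. F (fst y @ [polar n v]) (snd y))"
proof -
  let ?L = "{v :: bit list. length v = 2 ^ n}" and ?X = "source_vecs \<X> m (2 ^ n)"
  have last: "butlast us @ [polar n (polar n (last us))] = us"
    if "length us = Suc i" "\<forall>u\<in>set us. length u = 2 ^ n" for us
  proof -
    have "us \<noteq> []" using that(1) by auto
    then show ?thesis using that(2) by (simp add: polar_polar)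
  qed
  have "(\<Sum>(us, xs)\<in>bit_vecs (Suc i) (2 ^ n) \<times> ?X. F us xs) =
      (\<Sum>(y, v)\<in>(bit_vecs i (2 ^ n) \<times> ?X) \<times> ?L. F (fst y @ [polar n v]) (snd y))"
    by (rule sum.reindex_bij_witness[of _ "\<lambda>(y, v). (fst y @ [polar n v], snd y)"
          "\<lambda>(us, xs). ((butlast us, xs), polar n (last us))"])
      (auto simp: bit_vecs_def polar_polar last dest: in_set_butlastD)
  then show ?thesis by (simp add: sum.cartesian_product)
qed

lemma weight_Suc:
  assumes "length us = i" "length v = 2 ^ n"
  shows "weight \<beta> D n e (Suc i) (us @ [polar n v]) xs =
    weight \<beta> D n e i us xs * (\<Prod>k<2 ^ n. round_kernel p m \<beta> D n e i k (take k v) (seen m i (us, xs)) (v ! k))"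
proof -
  have "(\<Prod>l<i. \<Prod>k<2 ^ n. round_kernel p m \<beta> D n e l k (take k (polar n ((us @ [polar n v]) ! l)))
      (xs ! (l mod m), take l (us @ [polar n v])) (polar n ((us @ [polar n v]) ! l) ! k)) =
    (\<Prod>l<i. \<Prod>k<2 ^ n. round_kernel p m \<beta> D n e l k (take k (polar n (us ! l))) (xs ! (l mod m), take l us) (polar n (us ! l) ! k))"
    using assms by (intro prod.cong refl) (simp add: nth_append)
  moreover have "(us @ [polar n v]) ! i = polar n v" "take i (us @ [polar n v]) = us"
    using assms(1) by (simp_all add: nth_append)
  ultimately show ?thesis
    unfolding weight_def prod.lessThan_Suc using assms(2)
    by (simp only: polar_polar seen_def mult.assoc fst_conv snd_conv)
qed

lemma measure_X_vecs:
  assumes "xs \<in> source_vecs \<X> m (2 ^ n)"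
  shows "measure (ideal p n) {\<omega>. map (\<lambda>j. X_vec j \<omega>) [0..<m] = xs} =
    (\<Prod>k<2 ^ n. pmf (map_pmf fst p) (map (\<lambda>x. x ! k) xs))"
proof -
  let ?ys = "map (\<lambda>k. map (\<lambda>x. x ! k) xs) [0..<2 ^ n]"
  have xs: "length xs = m" "\<And>j. j < m \<Longrightarrow> length (xs ! j) = 2 ^ n"
    using assms by (auto simp: source_vecs_def)
  have "measure (ideal p n) {\<omega>. map (\<lambda>j. X_vec j \<omega>) [0..<m] = xs} = measure (ideal p n) {\<omega>. map fst \<omega> = ?ys}"
  proof (rule measure_pmf_cong_set)
    fix \<omega> assume w: "\<omega> \<in> set_pmf (ideal p n)"
    have len: "length (fst (\<omega> ! k)) = m" if "k < 2 ^ n" for k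
      using symbol[OF ideal_symbol[OF w that]] by simp
    show "map (\<lambda>j. X_vec j \<omega>) [0..<m] = xs \<longleftrightarrow> map fst \<omega> = ?ys"
      using xs len ideal_length[OF w] by (auto simp: list_eq_iff_nth_eq X_vec_def)
  qed
  also have "\<dots> = (\<Prod>k<2 ^ n. measure p {s. fst s = ?ys ! k})"
    unfolding ideal_def by (rule measure_map_replicate_pmf) simp
  also have "\<dots> = (\<Prod>k<2 ^ n. pmf (map_pmf fst p) (map (\<lambda>x. x ! k) xs))"
    by (intro prod.cong refl) (simp add: pmf_map vimage_def)
  finally show ?thesis .
qed

text \<open>The exponent \<open>e = 0\<close> gives the law \<open>Q\<close>; \<open>e = m\<close> gives the probability that the transcript is
  \<open>us\<close> and that the other \<open>m\<close> terminals have all reproduced it.\<close>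

lemma weight_error:
  assumes "i \<le> t"
  shows "(\<Sum>(us, xs)\<in>bit_vecs i (2 ^ n) \<times> source_vecs \<X> m (2 ^ n).
      \<bar>weight \<beta> D n e i us xs - measure (ideal p n) {\<omega>. past m i \<omega> = (us, xs)}\<bar>)
    \<le> real i * (2 ^ n * ((2 + real e) * sqrt (delta \<beta> n)))"
  using assms
proof (induction i)
  case 0
  \<comment> \<open>Before the first round only the sources are present, and their law is exact in
    \<open>weight\<close>.\<close>
  have "weight \<beta> D n e 0 us xs = measure (ideal p n) {\<omega>. past m 0 \<omega> = (us, xs)}"
    if "us \<in> bit_vecs 0 (2 ^ n)" "xs \<in> source_vecs \<X> m (2 ^ n)" for us xs
    using that(1) measure_X_vecs[OF that(2)] by (simp add: weight_def past_def bit_vecs_def)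
  then have "(\<Sum>(us, xs)\<in>bit_vecs 0 (2 ^ n) \<times> source_vecs \<X> m (2 ^ n).
      \<bar>weight \<beta> D n e 0 us xs - measure (ideal p n) {\<omega>. past m 0 \<omega> = (us, xs)}\<bar>) = 0"
    by (intro sum.neutral) auto
  then show ?case by simp
next
  case (Suc i)
  let ?SY = "bit_vecs i (2 ^ n) \<times> source_vecs \<X> m (2 ^ n)" and ?q = "ideal p n" and ?V = "V_vec n i"
  have i: "i < t" "i \<le> t" using Suc.prems by auto
  have "(\<Sum>(us, xs)\<in>bit_vecs (Suc i) (2 ^ n) \<times> source_vecs \<X> m (2 ^ n).
      \<bar>weight \<beta> D n e (Suc i) us xs - measure ?q {\<omega>. past m (Suc i) \<omega> = (us, xs)}\<bar>) =
      (\<Sum>y\<in>?SY. \<Sum>v | length v = 2 ^ n. \<bar>weight \<beta> D n e (Suc i) (fst y @ [polar n v]) (snd y) -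
         measure ?q {\<omega>. past m (Suc i) \<omega> = (fst y @ [polar n v], snd y)}\<bar>)"
    by (rule sum_bit_vecs_Suc)
  also have "\<dots> = (\<Sum>y\<in>?SY. \<Sum>v | length v = 2 ^ n.
      \<bar>weight \<beta> D n e i (fst y) (snd y) * (\<Prod>k<2 ^ n. round_kernel p m \<beta> D n e i k (take k v) (seen m i y) (v ! k)) -
       measure ?q {\<omega>. take (2 ^ n) (?V \<omega>) = v \<and> past m i \<omega> = y}\<bar>)"
  proof (intro sum.cong refl arg_cong[of _ _ abs] arg_cong2[of _ _ _ _ "(-)"])
    fix y v assume y: "y \<in> ?SY" and "v \<in> {v :: bit list. length v = 2 ^ n}"
    then have v: "length v = 2 ^ n" by simp
    show "weight \<beta> D n e (Suc i) (fst y @ [polar n v]) (snd y) =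
        weight \<beta> D n e i (fst y) (snd y) * (\<Prod>k<2 ^ n. round_kernel p m \<beta> D n e i k (take k v) (seen m i y) (v ! k))"
      using y weight_Suc[OF _ v, of "fst y" i \<beta> D e "snd y"] by (auto simp: bit_vecs_def)
    show "measure ?q {\<omega>. past m (Suc i) \<omega> = (fst y @ [polar n v], snd y)} =
        measure ?q {\<omega>. take (2 ^ n) (?V \<omega>) = v \<and> past m i \<omega> = y}"
    proof (rule measure_pmf_cong_set)
      fix \<omega> assume "\<omega> \<in> set_pmf ?q"
      then have "length (U_vec i \<omega>) = 2 ^ n" by (simp add: U_vec_def ideal_length)
      then have "U_vec i \<omega> = polar n v \<longleftrightarrow> ?V \<omega> = v"
        using v by (metis V_vec_def polar_polar)
      then show "past m (Suc i) \<omega> = (fst y @ [polar n v], snd y) \<longleftrightarrow> take (2 ^ n) (?V \<omega>) = v \<and> past m i \<omega> = y"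
        by (cases y) (auto simp: past_def V_vec_def)
    qed
  qed
  \<comment> \<open>One application of \<open>round_error\<close>: \<open>\<mu>\<close> is the
    weight of the earlier rounds, \<open>Y\<close> is \<open>past m i\<close> and \<open>h\<close>
    is \<open>seen m i\<close>.\<close>
  also have "\<dots> \<le> (\<Sum>y\<in>?SY. \<bar>weight \<beta> D n e i (fst y) (snd y) - measure ?q {\<omega>. past m i \<omega> = y}\<bar>) +
      (\<Sum>k<2 ^ n. mean ?q (\<lambda>\<omega>. \<Sum>b\<in>UNIV. \<bar>round_kernel p m \<beta> D n e i k (take k (?V \<omega>)) (seen m i (past m i \<omega>)) b -
         cprob ?q (\<lambda>\<omega>. ?V \<omega> ! k) (\<lambda>\<omega>. (take k (?V \<omega>), seen m i (past m i \<omega>))) \<omega> b\<bar>))"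
    by (rule round_error[where N = "2 ^ n" and \<mu> = "\<lambda>y. weight \<beta> D n e i (fst y) (snd y)"])
      (auto simp: V_vec_def[of n i] round_kernel_nonneg sum_round_kernel_le finite_ideal finite_bit_vecs finite_source_vecs
        intro: markov_V_vec[OF i(1), unfolded V_vec_def])
  also have "(\<Sum>y\<in>?SY. \<bar>weight \<beta> D n e i (fst y) (snd y) - measure ?q {\<omega>. past m i \<omega> = y}\<bar>) \<le>
      real i * (2 ^ n * ((2 + real e) * sqrt (delta \<beta> n)))"
    using Suc.IH[OF i(2)] by (simp add: case_prod_unfold)
  also have "(\<Sum>k<2 ^ n. mean ?q (\<lambda>\<omega>. \<Sum>b\<in>UNIV. \<bar>round_kernel p m \<beta> D n e i k (take k (?V \<omega>)) (seen m i (past m i \<omega>)) b -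
         cprob ?q (\<lambda>\<omega>. ?V \<omega> ! k) (\<lambda>\<omega>. (take k (?V \<omega>), seen m i (past m i \<omega>))) \<omega> b\<bar>)) \<le>
      (\<Sum>k<(2::nat) ^ n. (2 + real e) * sqrt (delta \<beta> n))"
    by (rule sum_mono) (simp add: round_kernel_error[OF i(1)])
  finally show ?case by (simp add: algebra_simps)
qed

end

subsection \<open>The protocol\<close>

lemma expectation_ge_on:
  assumes "\<And>x. x \<in> A \<Longrightarrow> c \<le> g x" "\<And>x. 0 \<le> g x" "\<And>x. g x \<le> (1 :: real)"
  shows "measure (measure_pmf M) A * c \<le> measure_pmf.expectation M g"
proof -
  have "measure (measure_pmf M) A * c = measure_pmf.expectation M (\<lambda>x. indicator A x * c)"
    by simp
  also have "\<dots> \<le> measure_pmf.expectation M g"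
  proof (rule integral_mono)
    show "integrable (measure_pmf M) g"
      using assms by (intro measure_pmf.integrable_const_bound[where B = 1]) auto
    show "indicator A x * c \<le> g x" for x
      using assms(1,2)[of x] by (auto simp: indicator_def)
    show "integrable (measure_pmf M) (\<lambda>x. indicator A x * c)"
      by (intro measure_pmf.integrable_const_bound[where B = "\<bar>c\<bar>"]) (auto simp: indicator_def)
  qed
  finally show ?thesis .
qed

lemma measure_bind_pmf_eq:
  "measure (measure_pmf (bind_pmf M f)) A = measure_pmf.expectation M (\<lambda>x. measure (measure_pmf (f x)) A)"
  unfolding measure_pmf_bind
  by (rule measure_pmf.measure_bind[where N = "count_space UNIV"]) (auto simp: measure_subprob)

text \<open>Outcomes outside \<open>E\<close> are discarded. In the application these are the runs
  with an earlier disagreement.\<close>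

lemma measure_bind_pmf_ge:
  assumes "\<And>x. x \<in> E \<Longrightarrow> c \<le> measure (measure_pmf (f x)) A"
  shows "measure (measure_pmf M) E * c \<le> measure (measure_pmf (bind_pmf M f)) A"
  unfolding measure_bind_pmf_eq by (rule expectation_ge_on) (auto simp: assms)

lemma pmf_sequential_pmf:
  assumes "length v = n"
  shows "pmf (sequential_pmf \<kappa> n) v = (\<Prod>k<n. pmf (\<kappa> k (take k v)) (v ! k))"
  using assms
proof (induction n arbitrary: v)
  case (Suc n)
  obtain v' b where v: "v = v' @ [b]" "length v' = n"
    using Suc.prems by (metis append_butlast_last_id diff_Suc_1 length_0_conv length_butlast nat.distinct(1))
  have inner: "pmf (bind_pmf (\<kappa> n x) (\<lambda>b. return_pmf (x @ [b]))) v = indicator {v'} x * pmf (\<kappa> n v') b" for x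
  proof (cases "x = v'")
    case True
    have "pmf (map_pmf (\<lambda>b. v' @ [b]) (\<kappa> n v')) (v' @ [b]) = pmf (\<kappa> n v') b"
      by (rule pmf_map_inj') (auto simp: inj_on_def)
    then show ?thesis using True v by (simp add: map_pmf_def)
  next
    case False
    then have "v \<notin> set_pmf (bind_pmf (\<kappa> n x) (\<lambda>b. return_pmf (x @ [b])))"
      using v by auto
    then show ?thesis using False by (simp add: pmf_eq_0_set_pmf)
  qed
  have "pmf (sequential_pmf \<kappa> (Suc n)) v = pmf (sequential_pmf \<kappa> n) v' * pmf (\<kappa> n v') b"
    unfolding sequential_pmf.simps pmf_bind[of "sequential_pmf \<kappa> n" _ v] inner by (simp add: measure_pmf_single)
  also have "pmf (sequential_pmf \<kappa> n) v' = (\<Prod>k<n. pmf (\<kappa> k (take k v)) (v ! k))"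
    unfolding Suc.IH[OF v(2)] using v by (intro prod.cong refl) (simp add: nth_append)
  finally show ?case using v by (simp add: nth_append)
qed simp

text \<open>A copied bit is a point mass at the broadcaster's bit, here evaluated exactly at that
  bit.\<close>

lemma recv_kernel_eq_agree_prob:
  "pmf (recv_kernel p m \<beta> D n i v k w us) (v ! k) = agree_prob p m \<beta> D n i k w us (v ! k)"
  by (simp add: recv_kernel_def agree_prob_def)

text \<open>One way to reach the event is that the broadcaster draws \<open>v\<close> and that every
  receiver then draws \<open>v\<close> too. Since all versions of the past are \<open>us\<close>,
  each receiver succeeds with the same probability \<open>a\<close>, independently of the
  others.\<close>

lemma protocol_round_ge:
  assumes "m \<ge> 1" "length v = 2 ^ n" "\<And>r. r \<le> m \<Longrightarrow> S r = us"
  shows "(\<Prod>k<2 ^ n. round_kernel p m \<beta> D n m i k (take k v) (xs ! (i mod m), us) (v ! k)) \<le>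
    measure (protocol_round p m \<beta> D n i xs S) {S'. \<forall>r\<le>m. S' r = us @ [polar n v]}"
proof -
  let ?j = "i mod m" and ?N = "2 ^ n :: nat"
  let ?A = "{S'. \<forall>r\<le>m. S' r = us @ [polar n v]}" and ?R = "{..m} - {?j}"
  let ?gen = "sequential_pmf (\<lambda>k v. gen_kernel p m \<beta> D n i k v (xs ! ?j) (S ?j)) ?N"
  let ?recv = "\<lambda>vb r. sequential_pmf (\<lambda>k v. recv_kernel p m \<beta> D n i vb k v (S r)) ?N"
  let ?out = "\<lambda>vb vr. return_pmf (\<lambda>r. S r @ [polar n (if r = ?j then vb else vr r)])"
  have j: "?j < m" using assms(1) by simp
  \<comment> \<open>There are \<open>m + 1\<close> terminals, the \<open>m\<close> sources and the
    sink, and one of them broadcasts; this is the origin of the exponent \<open>m\<close>.\<close>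
  have card: "card ?R = m" using j by simp
  define a where "a = (\<Prod>k<?N. agree_prob p m \<beta> D n i k (take k v) us (v ! k))"
  have recv: "pmf (?recv v r) v = a" if "r \<in> ?R" for r
    using that assms by (simp add: a_def pmf_sequential_pmf recv_kernel_eq_agree_prob)
  have "measure (Pi_pmf ?R [] (?recv v)) (Pi ?R (\<lambda>_. {v})) * 1 \<le>
      measure (bind_pmf (Pi_pmf ?R [] (?recv v)) (?out v)) ?A"
    by (rule measure_bind_pmf_ge) (use assms(3) in \<open>auto simp: indicator_def measure_return_pmf Pi_iff\<close>)
  also have "measure (Pi_pmf ?R [] (?recv v)) (Pi ?R (\<lambda>_. {v})) = a ^ m"
    by (subst measure_Pi_pmf_Pi) (simp_all add: measure_pmf_single recv card)
  finally have inner: "a ^ m \<le> measure (bind_pmf (Pi_pmf ?R [] (?recv v)) (?out v)) ?A" by simp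
  have "measure ?gen {v} * a ^ m \<le>
      measure (bind_pmf ?gen (\<lambda>vb. bind_pmf (Pi_pmf ?R [] (?recv vb)) (?out vb))) ?A"
    by (rule measure_bind_pmf_ge) (use inner in auto)
  moreover have "measure ?gen {v} * a ^ m =
      (\<Prod>k<?N. round_kernel p m \<beta> D n m i k (take k v) (xs ! ?j, us) (v ! k))"
    using assms j
    by (simp add: measure_pmf_single pmf_sequential_pmf a_def round_kernel_def prod.distrib prod_power_distrib)
  ultimately show ?thesis by (simp only: protocol_round_def Let_def)
qed

context polar_source
begin

text \<open>Agreement of all terminals on the whole past is exactly what
  \<open>protocol_round_ge\<close> requires, so the induction is unaffected by the change of
  broadcaster.\<close>

lemma rounds_ge:
  assumes "us \<in> bit_vecs i (2 ^ n)"
  shows "(\<Prod>l<i. \<Prod>k<2 ^ n. round_kernel p m \<beta> D n m l k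
       (take k (polar n (us ! l))) (xs ! (l mod m), take l us) (polar n (us ! l) ! k)) \<le>
    measure (rounds p m \<beta> D n xs i) {S. \<forall>r\<le>m. S r = us}"
  using assms
proof (induction i arbitrary: us)
  case 0
  then show ?case by (simp add: bit_vecs_def)
next
  case (Suc i)
  obtain us' u where us: "us = us' @ [u]" "length us' = i" "length u = 2 ^ n"
  proof
    have "us \<noteq> []" using Suc.prems by (auto simp: bit_vecs_def)
    then show "us = butlast us @ [last us]" "length (butlast us) = i" "length (last us) = 2 ^ n"
      using Suc.prems by (auto simp: bit_vecs_def)
  qed
  have us': "us' \<in> bit_vecs i (2 ^ n)" using Suc.prems by (auto simp: bit_vecs_def us)
  let ?E = "{S. \<forall>r\<le>m. S r = us'}" and ?A = "{S. \<forall>r\<le>m. S r = us}"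
  let ?W = "\<lambda>us l. \<Prod>k<2 ^ n. round_kernel p m \<beta> D n m l k
       (take k (polar n (us ! l))) (xs ! (l mod m), take l us) (polar n (us ! l) ! k)"
  have step: "?W us i \<le> measure (protocol_round p m \<beta> D n i xs S) ?A" if "S \<in> ?E" for S
    using protocol_round_ge[OF m_pos, of "polar n u" n S us' p \<beta> D i xs] that
    by (simp add: us polar_polar nth_append)
  have "(\<Prod>l<i. ?W us l) = (\<Prod>l<i. ?W us' l)"
    by (intro prod.cong refl) (simp add: us nth_append)
  also have "\<dots> \<le> measure (rounds p m \<beta> D n xs i) ?E"
    by (rule Suc.IH[OF us'])
  finally have "(\<Prod>l<Suc i. ?W us l) \<le> measure (rounds p m \<beta> D n xs i) ?E * ?W us i"
    unfolding prod.lessThan_Suc by (intro mult_right_mono prod_nonneg) (auto simp: round_kernel_nonneg)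
  also have "\<dots> \<le> measure (rounds p m \<beta> D n xs (Suc i)) ?A"
    unfolding rounds.simps by (rule measure_bind_pmf_ge) (rule step)
  finally show ?case .
qed

lemma past_in:
  assumes "\<omega> \<in> set_pmf (ideal p n)"
  shows "past m i \<omega> \<in> bit_vecs i (2 ^ n) \<times> source_vecs \<X> m (2 ^ n)"
proof -
  have "fst s ! j \<in> \<X> j" if "s \<in> set \<omega>" "j < m" for s j
    using assms that symbol[of s] by (auto simp: ideal_def set_replicate_pmf)
  then show ?thesis
    using ideal_length[OF assms]
    by (auto simp: past_def bit_vecs_def source_vecs_def U_vec_def X_vec_def simp del: split_paired_All)
qed

lemma pmf_sources:
  assumes "xs \<in> source_vecs \<X> m (2 ^ n)"
  shows "pmf (sources p m n) xs = (\<Prod>k<2 ^ n. pmf (map_pmf fst p) (map (\<lambda>x. x ! k) xs))"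
  unfolding measure_X_vecs[OF assms, symmetric] sources_def map_replicate_pmf[symmetric] ideal_def
  by (simp add: pmf_map vimage_def pmf.map_comp o_def X_vec_def)

lemma set_sources: "set_pmf (sources p m n) \<subseteq> source_vecs \<X> m (2 ^ n)"
proof
  fix xs assume "xs \<in> set_pmf (sources p m n)"
  then obtain \<omega> where "\<omega> \<in> set_pmf (ideal p n)" "xs = snd (past m 0 \<omega>)"
    unfolding sources_def map_replicate_pmf[symmetric] ideal_def
    by (auto simp: past_def X_vec_def)
  then show "xs \<in> source_vecs \<X> m (2 ^ n)" using past_in[of \<omega> n 0] by auto
qed

text \<open>Full agreement on a transcript implies agreement in round \<open>l\<close>, and
  different transcripts give disjoint events. The probability is therefore at least the total
  weight, which is at least 1 minus the \<open>l1\<close> error because the ideal law has mass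
  1.\<close>

lemma protocol_agreement:
  assumes "l < t" "r \<le> m"
  shows "1 - measure (protocol p m t \<beta> D n) {S. S (l mod m) ! l = S r ! l}
    \<le> real t * (2 ^ n * ((2 + real m) * sqrt (delta \<beta> n)))"
proof -
  let ?B = "{S :: nat \<Rightarrow> bit list list. S (l mod m) ! l = S r ! l}"
  let ?U = "bit_vecs t (2 ^ n)" and ?X = "source_vecs \<X> m (2 ^ n)"
  let ?E = "\<lambda>us. {S :: nat \<Rightarrow> bit list list. \<forall>r\<le>m. S r = us}"
  let ?P = "\<lambda>y. measure (ideal p n) {\<omega>. past m t \<omega> = y}"
  let ?w = "\<lambda>us xs. \<Prod>l<t. \<Prod>k<2 ^ n. round_kernel p m \<beta> D n m l k
       (take k (polar n (us ! l))) (xs ! (l mod m), take l us) (polar n (us ! l) ! k)"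
  have rounds: "(\<Sum>us\<in>?U. ?w us xs) \<le> measure (rounds p m \<beta> D n xs t) ?B" for xs
  proof -
    have "(\<Sum>us\<in>?U. ?w us xs) \<le> (\<Sum>us\<in>?U. measure (rounds p m \<beta> D n xs t) (?E us))"
      by (intro sum_mono rounds_ge)
    also have "\<dots> = measure (rounds p m \<beta> D n xs t) (\<Union>us\<in>?U. ?E us)"
      by (rule measure_pmf.finite_measure_finite_Union[symmetric])
        (auto simp: disjoint_family_on_def finite_bit_vecs)
    also have "\<dots> \<le> measure (rounds p m \<beta> D n xs t) ?B"
      using mod_m_less[of l] assms(2) by (intro measure_pmf.finite_measure_mono) auto
    finally show ?thesis .
  qed
  have "1 = measure (ideal p n) {\<omega>. True \<and> True}" by simp
  also have "\<dots> = (\<Sum>y\<in>?U \<times> ?X. ?P y)"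
    using measure_by_value[of "ideal p n" "?U \<times> ?X" "past m t" "\<lambda>_. True" "\<lambda>_. True"]
    by (simp add: finite_ideal finite_bit_vecs finite_source_vecs past_in)
  \<comment> \<open>Termwise \<open>P \<le> w + \<bar>w - P\<bar>\<close>.\<close>
  also have "\<dots> \<le> (\<Sum>(us, xs)\<in>?U \<times> ?X. weight \<beta> D n m t us xs) +
      (\<Sum>(us, xs)\<in>?U \<times> ?X. \<bar>weight \<beta> D n m t us xs - ?P (us, xs)\<bar>)"
    unfolding sum.distrib[symmetric] by (intro sum_mono) auto
  also have "\<dots> \<le> (\<Sum>(us, xs)\<in>?U \<times> ?X. weight \<beta> D n m t us xs) +
      real t * (2 ^ n * ((2 + real m) * sqrt (delta \<beta> n)))"
    by (intro add_left_mono weight_error order_refl)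
  also have "(\<Sum>(us, xs)\<in>?U \<times> ?X. weight \<beta> D n m t us xs) =
      (\<Sum>us\<in>?U. \<Sum>xs\<in>?X. pmf (sources p m n) xs * ?w us xs)"
    unfolding sum.cartesian_product[symmetric] weight_def by (intro sum.cong refl) (simp add: pmf_sources)
  also have "\<dots> = (\<Sum>xs\<in>?X. pmf (sources p m n) xs * (\<Sum>us\<in>?U. ?w us xs))"
    unfolding sum_distrib_left by (rule sum.swap)
  also have "\<dots> \<le> (\<Sum>xs\<in>?X. pmf (sources p m n) xs * measure (rounds p m \<beta> D n xs t) ?B)"
    by (intro sum_mono mult_left_mono rounds) simp
  also have "\<dots> = measure (protocol p m t \<beta> D n) ?B"
    unfolding protocol_def measure_bind_pmf_eq
    using set_sources by (subst integral_measure_pmf_real[OF finite_source_vecs]) (auto simp: mult.commute)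
  finally show ?thesis by simp
qed

text \<open>The indicators leave a single summand, the transforms of \<open>us\<close>, and the
  exponent 0 removes the agreement factors.\<close>

lemma Q_UX_eq_weight:
  assumes "us \<in> bit_vecs t (2 ^ n)"
  shows "Q_UX p m t \<beta> D n us xs = weight \<beta> D n 0 t us xs"
proof -
  let ?vs = "map (polar n) us"
  have us: "length us = t" using assms by (simp add: bit_vecs_def)
  have "Q_UX p m t \<beta> D n us xs = (\<Sum>vs\<in>bit_vecs t (2 ^ n). if vs = ?vs then Q_UVX p m t \<beta> D n us ?vs xs else 0)"
    unfolding Q_UX_def
  proof (intro sum.cong refl)
    fix vs :: "bit list list" assume "vs \<in> bit_vecs t (2 ^ n)"
    then have "length vs = t" by (simp add: bit_vecs_def)
    show "Q_UVX p m t \<beta> D n us vs xs = (if vs = ?vs then Q_UVX p m t \<beta> D n us ?vs xs else 0)"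
    proof (cases "vs = ?vs")
      case False
      have "\<not> (\<forall>l<t. vs ! l = ?vs ! l)"
        using False us \<open>length vs = t\<close> by (simp add: list_eq_iff_nth_eq)
      then obtain l where "l < t" "vs ! l \<noteq> ?vs ! l" by blast
      with us have "l < t" "polar n (us ! l) \<noteq> vs ! l" by simp_all
      then have "(\<Prod>i<t. if polar n (us ! i) = vs ! i then 1 else 0 :: real) = 0"
        by (intro prod_zero) auto
      with False show ?thesis by (simp only: Q_UVX_def mult_zero_left mult_zero_right if_False)
    qed simp
  qed
  also have "\<dots> = Q_UVX p m t \<beta> D n us ?vs xs"
  proof -
    have "?vs \<in> bit_vecs t (2 ^ n)" using us by (auto simp: bit_vecs_def)
    then show ?thesis by (simp only: sum.delta finite_bit_vecs if_True)
  qed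
  also have "\<dots> = weight \<beta> D n 0 t us xs"
  proof -
    have "(\<Prod>i<t. if polar n (us ! i) = ?vs ! i then 1 else 0 :: real) = 1"
      using us by (intro prod.neutral) simp
    moreover have "(\<Prod>i<t. \<Prod>k<2 ^ n. pmf (gen_kernel p m \<beta> D n i k (take k (?vs ! i)) (xs ! (i mod m)) (take i us)) (?vs ! i ! k)) =
        (\<Prod>i<t. \<Prod>k<2 ^ n. pmf (gen_kernel p m \<beta> D n i k (take k (polar n (us ! i))) (xs ! (i mod m)) (take i us)) (polar n (us ! i) ! k))"
      using us by (intro prod.cong refl) simp
    ultimately show ?thesis
      by (simp only: Q_UVX_def weight_def round_kernel_def power_0 mult_1_right fst_conv snd_conv)
  qed
  finally show ?thesis .
qed

lemma l1_dist_Q_P: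
  "l1_dist (bit_vecs t (2 ^ n) \<times> source_vecs \<X> m (2 ^ n))
     (\<lambda>(us, xs). Q_UX p m t \<beta> D n us xs) (\<lambda>(us, xs). P_UX p m t n us xs)
   \<le> real t * (2 ^ n * (2 * sqrt (delta \<beta> n)))"
proof -
  have "l1_dist (bit_vecs t (2 ^ n) \<times> source_vecs \<X> m (2 ^ n))
      (\<lambda>(us, xs). Q_UX p m t \<beta> D n us xs) (\<lambda>(us, xs). P_UX p m t n us xs) =
    (\<Sum>(us, xs)\<in>bit_vecs t (2 ^ n) \<times> source_vecs \<X> m (2 ^ n).
      \<bar>weight \<beta> D n 0 t us xs - measure (ideal p n) {\<omega>. past m t \<omega> = (us, xs)}\<bar>)"
    unfolding l1_dist_def by (intro sum.cong refl) (auto simp: Q_UX_eq_weight P_UX_def pmf_map vimage_def past_def)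
  then show ?thesis using weight_error[where i = t and n = n and \<beta> = \<beta> and D = D and e = 0] by simp
qed

end

subsection \<open>From random variables to the law of a symbol\<close>

text \<open>\<open>Abs_pmf\<close> is meaningful only for a probability measure on all sets in which
  almost every point has positive mass; a finite range provides this.\<close>

lemma measure_pmf_law_pmf:
  assumes "prob_space M" and Y: "Y \<in> measurable M (count_space UNIV)" and "finite (Y ` space M)"
  shows "measure_pmf (law_pmf M Y) = distr M (count_space UNIV) Y"
proof -
  interpret D: prob_space "distr M (count_space UNIV) Y"
    by (rule prob_space.prob_space_distr[OF assms(1) Y])
  have "\<exists>S. countable S \<and> (AE x in distr M (count_space UNIV) Y. x \<in> S)"
    using countable_finite[OF assms(3)] by (intro exI[of _ "Y ` space M"]) (auto simp: AE_distr_iff[OF Y])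
  then have "AE x in distr M (count_space UNIV) Y. measure (distr M (count_space UNIV) Y) {x} \<noteq> 0"
    by (subst D.AE_support_countable) simp_all
  then show ?thesis
    unfolding law_pmf_def by (intro Abs_pmf_inverse) (simp add: D.prob_space_axioms)
qed

lemma measure_law_pmf:
  assumes "prob_space M" "Y \<in> measurable M (count_space UNIV)" "finite (Y ` space M)"
  shows "measure (law_pmf M Y) {y. P y} = measure M {\<omega> \<in> space M. P (Y \<omega>)}"
  unfolding measure_pmf_law_pmf[OF assms]
  by (subst measure_distr[OF assms(2)]) (auto intro!: arg_cong[of _ _ "measure M"])

lemma set_law_pmf:
  assumes "prob_space M" "Y \<in> measurable M (count_space UNIV)" "finite (Y ` space M)"
  shows "set_pmf (law_pmf M Y) \<subseteq> Y ` space M"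
proof
  fix y assume y: "y \<in> set_pmf (law_pmf M Y)"
  have "measure (law_pmf M Y) {x. x = y} > 0"
    by (rule measure_pmf_posI[OF y]) simp
  then have "{\<omega> \<in> space M. Y \<omega> = y} \<noteq> {}"
    unfolding measure_law_pmf[OF assms] by (intro notI) simp
  then show "y \<in> Y ` space M" by auto
qed

text \<open>With \<open>N = 2 ^ n\<close> the error is a constant times \<open>N\<close> times the
  square root of \<open>delta\<close>. Since \<open>\<beta>\<^sub>7 < \<beta>\<close>, the exponent
  \<open>N powr \<beta> / 2\<close> eventually exceeds \<open>N powr \<beta>\<^sub>7\<close> by more
  than the logarithm of \<open>N\<close>.\<close>

lemma error_bigo:
  assumes "0 < \<beta>\<^sub>7" "\<beta>\<^sub>7 < \<beta>"
  shows "(\<lambda>n. c * (2 ^ n * (d * sqrt (delta \<beta> n)))) \<in> O(\<lambda>n. 2 powr - (real (2 ^ n) powr \<beta>\<^sub>7))"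
proof -
  have "(\<lambda>x :: real. x * 2 powr (- (x powr \<beta>) / 2)) \<in> O(\<lambda>x. 2 powr - (x powr \<beta>\<^sub>7))"
    using assms by real_asymp
  moreover have "filterlim (\<lambda>n. real (2 ^ n)) at_top sequentially"
    by real_asymp
  ultimately have "(\<lambda>n. real (2 ^ n) * 2 powr (- (real (2 ^ n) powr \<beta>) / 2)) \<in>
      O(\<lambda>n. 2 powr - (real (2 ^ n) powr \<beta>\<^sub>7))"
    by (rule landau_o.big.compose)
  moreover have "sqrt (delta \<beta> n) = 2 powr (- (real (2 ^ n) powr \<beta>) / 2)" for n
    by (simp add: delta_def powr_half_sqrt[symmetric] powr_powr)
  ultimately have "(\<lambda>n. 2 ^ n * sqrt (delta \<beta> n)) \<in> O(\<lambda>n. 2 powr - (real (2 ^ n) powr \<beta>\<^sub>7))"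
    by simp
  moreover have "(\<lambda>n. c * (2 ^ n * (d * sqrt (delta \<beta> n)))) \<in> O(\<lambda>n. 2 ^ n * sqrt (delta \<beta> n))"
    by (rule bigoI[where c = "\<bar>c * d\<bar>"]) (simp add: abs_mult mult_ac)
  ultimately show ?thesis by (rule landau_o.big_trans[rotated])
qed

lemma polar_source_law:
  fixes M :: "'w measure" and m t :: nat
    and X :: "nat \<Rightarrow> 'w \<Rightarrow> 'a" and \<X> :: "nat \<Rightarrow> 'a set" and U :: "nat \<Rightarrow> 'w \<Rightarrow> bit"
  defines "XX \<equiv> \<lambda>\<omega>. map (\<lambda>j. X j \<omega>) [0..<m]"
    and "UU \<equiv> \<lambda>i \<omega>. map (\<lambda>l. U l \<omega>) [0..<i]"
  assumes "prob_space M" and "m \<ge> 1"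
    and fin: "\<And>j. j < m \<Longrightarrow> finite (\<X> j)"
    and X: "\<And>j. j < m \<Longrightarrow> X j \<in> measurable M (count_space (\<X> j))"
    and U: "\<And>i. i < t \<Longrightarrow> U i \<in> measurable M (count_space UNIV)"
    and markov: "\<And>i. i < t \<Longrightarrow>
           markov_chain M (U i) (\<lambda>\<omega>. (UU i \<omega>, X (i mod m) \<omega>))
             (\<lambda>\<omega>. map (\<lambda>l. X l \<omega>) (filter (\<lambda>l. l \<noteq> i mod m) [0..<m]))"
  shows "polar_source (law_pmf M (\<lambda>\<omega>. (XX \<omega>, UU t \<omega>))) m t \<X>"
proof -
  let ?Y = "\<lambda>\<omega>. (XX \<omega>, UU t \<omega>)"
  let ?A = "{xs. set xs \<subseteq> (\<Union>j<m. \<X> j) \<and> length xs = m} \<times> {us :: bit list. length us = t}"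
  have X_in: "X j \<omega> \<in> \<X> j" if "j < m" "\<omega> \<in> space M" for j \<omega>
    using measurable_space[OF X[OF that(1)] that(2)] by simp
  have "finite ?A"
    using fin by (intro finite_cartesian_product finite_lists_length_eq finite_bit_lists) auto
  moreover have range: "?Y ` space M \<subseteq> ?A"
    using X_in by (fastforce simp: XX_def UU_def)
  ultimately have finY: "finite (?Y ` space M)" by (rule rev_finite_subset)
  have Y: "?Y \<in> measurable M (count_space UNIV)"
  proof -
    have "?Y -` {a} \<inter> space M \<in> sets M" for a
    proof -
      have x: "{\<omega> \<in> space M. X j \<omega> = x} \<in> sets M" if "j < m" for j x
      proof -
        \<comment> \<open>The intersection with the alphabet is needed because \<open>x\<close> is
          arbitrary and only subsets of \<open>\<X> j\<close> are measurable in the target.\<close>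
        have "{\<omega> \<in> space M. X j \<omega> = x} = X j -` ({x} \<inter> \<X> j) \<inter> space M"
          using X_in[OF that] by auto
        also have "\<dots> \<in> sets M" by (rule measurable_sets[OF X[OF that]]) simp
        finally show ?thesis .
      qed
      have u: "{\<omega> \<in> space M. U l \<omega> = b} \<in> sets M" if "l < t" for l b
      proof -
        have "{\<omega> \<in> space M. U l \<omega> = b} = U l -` {b} \<inter> space M" by auto
        also have "\<dots> \<in> sets M" by (rule measurable_sets[OF U[OF that]]) simp
        finally show ?thesis .
      qed
      show ?thesis
      proof (cases "length (fst a) = m \<and> length (snd a) = t")
        case True
        have eq: "(XX \<omega>, UU t \<omega>) = a \<longleftrightarrow> (\<forall>j\<in>{..<m}. X j \<omega> = fst a ! j) \<and> (\<forall>l\<in>{..<t}. U l \<omega> = snd a ! l)" for \<omega>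
          using True by (cases a) (simp add: XX_def UU_def list_eq_iff_nth_eq Ball_def)
        have "?Y -` {a} \<inter> space M =
            {\<omega> \<in> space M. (\<forall>j\<in>{..<m}. X j \<omega> = fst a ! j) \<and> (\<forall>l\<in>{..<t}. U l \<omega> = snd a ! l)}"
          unfolding eq[symmetric] by blast
        also have "\<dots> \<in> sets M"
          by (intro sets.sets_Collect_conj sets.sets_Collect_finite_All' sets.sets_Collect_finite_All x u) auto
        finally show ?thesis .
      next
        case False
        then have "?Y -` {a} \<inter> space M = {}" by (auto simp: XX_def UU_def)
        then show ?thesis by simp
      qed
    qed
    \<comment> \<open>Measurable fibers suffice for a countable target, and the type of symbols may
      be uncountable. Measurability is therefore shown into the finite image first and then
      transferred along the inclusion.\<close>
    then have "?Y \<in> measurable M (count_space (?Y ` space M))"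
      using finY by (subst measurable_count_space_eq2) auto
    from measurable_compose[OF this, of "\<lambda>x. x" "count_space UNIV"] show ?thesis by simp
  qed
  note measure = measure_law_pmf[OF assms(3) Y finY] and set = set_law_pmf[OF assms(3) Y finY]
  show ?thesis
  proof
    show "m \<ge> 1" "\<And>j. j < m \<Longrightarrow> finite (\<X> j)" by fact+
    show "finite (set_pmf (law_pmf M ?Y))" by (rule finite_subset[OF set finY])
    fix s assume "s \<in> set_pmf (law_pmf M ?Y)"
    then show "length (fst s) = m \<and> length (snd s) = t \<and> (\<forall>j<m. fst s ! j \<in> \<X> j)"
      using set X_in by (auto simp: XX_def UU_def)
  next
    fix i assume i: "i < t"
    let ?c = "\<lambda>s :: 'a symbol. map (\<lambda>l. fst s ! l) (filter (\<lambda>l. l \<noteq> i mod m) [0..<m])"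
    have Y_simps: "snd (?Y \<omega>) ! i = U i \<omega>" "take i (snd (?Y \<omega>)) = UU i \<omega>"
      "fst (?Y \<omega>) ! (i mod m) = X (i mod m) \<omega>"
      "?c (?Y \<omega>) = map (\<lambda>l. X l \<omega>) (filter (\<lambda>l. l \<noteq> i mod m) [0..<m])" for \<omega>
      using i \<open>m \<ge> 1\<close> unfolding XX_def UU_def fst_conv snd_conv
      by (simp_all add: take_map take_upt)
    show "markov_chain (measure_pmf (law_pmf M ?Y)) (\<lambda>s. snd s ! i)
        (\<lambda>s. (take i (snd s), fst s ! (i mod m))) ?c"
      using markov[OF i] unfolding markov_chain_def space_measure_pmf
      by (simp only: UNIV_I simp_thms measure Y_simps)
  qed
qed

theorem lemma9:
  fixes M :: "'w measure" and m t :: nat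
    and X :: "nat \<Rightarrow> 'w \<Rightarrow> 'a" and \<X> :: "nat \<Rightarrow> 'a set" and U :: "nat \<Rightarrow> 'w \<Rightarrow> bit"
    and f :: "'a list \<Rightarrow> 'b" and \<beta> \<beta>\<^sub>7 :: real and D :: "'a null_laws"
  defines "XX \<equiv> \<lambda>\<omega>. map (\<lambda>j. X j \<omega>) [0..<m]"
    and "UU \<equiv> \<lambda>i \<omega>. map (\<lambda>l. U l \<omega>) [0..<i]"
  defines "p \<equiv> law_pmf M (\<lambda>\<omega>. (XX \<omega>, UU t \<omega>))"
  assumes "prob_space M" and "m \<ge> 1" and "t \<ge> 1"
    and "\<And>j. j < m \<Longrightarrow> finite (\<X> j)"
    and "prob_space.indep_vars M (\<lambda>j. count_space (\<X> j)) X {..<m}"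
    and "\<And>i. i < t \<Longrightarrow> U i \<in> measurable M (count_space UNIV)"
    and "prob_space.conditional_entropy M 2
           (count_space ((\<lambda>\<omega>. f (XX \<omega>)) ` space M)) (count_space (UU t ` space M))
           (\<lambda>\<omega>. f (XX \<omega>)) (UU t) = 0"
    and "\<And>i. i < t \<Longrightarrow>
           markov_chain M (U i) (\<lambda>\<omega>. (UU i \<omega>, X (i mod m) \<omega>))
             (\<lambda>\<omega>. map (\<lambda>l. X l \<omega>) (filter (\<lambda>l. l \<noteq> i mod m) [0..<m]))"
    and "0 < \<beta>\<^sub>7" and "\<beta>\<^sub>7 < \<beta>" and "\<beta> < 1 / 2"
  shows "(\<forall>l<t. \<forall>r\<le>m. r \<noteq> l mod m \<longrightarrow>
            (\<lambda>n. 1 - \<P>(S in protocol p m t \<beta> D n. S (l mod m) ! l = S r ! l))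
              \<in> O(\<lambda>n. 2 powr - (real (2 ^ n) powr \<beta>\<^sub>7))) \<and>
         (\<lambda>n. l1_dist (bit_vecs t (2 ^ n) \<times> source_vecs \<X> m (2 ^ n))
                (\<lambda>(us, xs). Q_UX p m t \<beta> D n us xs) (\<lambda>(us, xs). P_UX p m t n us xs))
              \<in> O(\<lambda>n. 2 powr - (real (2 ^ n) powr \<beta>\<^sub>7))"
proof -
  \<comment> \<open>Independence of a family includes the measurability of its members.\<close>
  have X: "X j \<in> measurable M (count_space (\<X> j))" if "j < m" for j
    using assms(8) that unfolding prob_space.indep_vars_def[OF assms(4)] by auto
  interpret polar_source p m t \<X>
    unfolding p_def XX_def UU_def
    by (rule polar_source_law[OF assms(4,5,7) X assms(9) assms(11)[unfolded UU_def]])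
  \<comment> \<open>Both claims bound a nonnegative quantity for every \<open>n\<close>; they differ
    only in the constant \<open>d\<close>, which is \<open>2 + m\<close> for the agreement and 2 for
    the distance.\<close>
  have bigo: "g \<in> O(\<lambda>n. 2 powr - (real (2 ^ n) powr \<beta>\<^sub>7))"
    if "\<And>n. 0 \<le> g n" "\<And>n. g n \<le> real t * (2 ^ n * (d * sqrt (delta \<beta> n)))" for g and d :: real
  proof -
    have "g \<in> O(\<lambda>n. real t * (2 ^ n * (d * sqrt (delta \<beta> n))))"
      using that by (intro bigoI[where c = 1] always_eventually allI) (smt (verit) real_norm_def)
    then show ?thesis using error_bigo[OF assms(12,13)] by (rule landau_o.big_trans)
  qed
  show ?thesis
  proof (intro conjI allI impI)
    fix l r assume lr: "l < t" "r \<le> m"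
    show "(\<lambda>n. 1 - \<P>(S in protocol p m t \<beta> D n. S (l mod m) ! l = S r ! l))
        \<in> O(\<lambda>n. 2 powr - (real (2 ^ n) powr \<beta>\<^sub>7))"
      using protocol_agreement[OF lr] by (intro bigo[where d = "2 + real m"]) simp_all
  next
    show "(\<lambda>n. l1_dist (bit_vecs t (2 ^ n) \<times> source_vecs \<X> m (2 ^ n))
        (\<lambda>(us, xs). Q_UX p m t \<beta> D n us xs) (\<lambda>(us, xs). P_UX p m t n us xs))
        \<in> O(\<lambda>n. 2 powr - (real (2 ^ n) powr \<beta>\<^sub>7))"
      using l1_dist_Q_P by (intro bigo[where d = 2]) (simp_all add: l1_dist_def sum_nonneg)
  qed
qed

end
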